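(* Let $\Omega\subseteq\mathbb{C}^n$ be a bounded domain, let $\mathcal{H},\tilde{\mathcal{H}}\in B_1^*(\Omega)$ be such that $\mathcal{M}(\mathcal{H})\subseteq\mathcal{M}(\tilde{\mathcal{H}})$, and let $\Theta\in\mathcal{M}_{\mathcal{B}(\mathbb{C}^p,\mathbb{C}^q)}(\mathcal{H})$, for $1\le p<q$, be left invertible. Then the similarity of $\mathcal{H}_\Theta=(\mathcal{H}\otimes\mathbb{C}^q)/M_\Theta(\mathcal{H}\otimes\mathbb{C}^p)$ to $\mathcal{H}\otimes\mathbb{C}^{q-p}$ implies the similarity of $\tilde{\mathcal{H}}_\Theta=(\tilde{\mathcal{H}}\otimes\mathbb{C}^q)/M_\Theta(\tilde{\mathcal{H}}\otimes\mathbb{C}^p)$ to $\tilde{\mathcal{H}}\otimes\mathbb{C}^{q-p}$.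
   Context: All Hilbert spaces are complex and separable. A Hilbert module over $\mathbb{C}[\boldsymbol{z}]=\mathbb{C}[z_1,\dots,z_n]$ is a Hilbert space $\mathcal{H}$ with a commuting tuple $(M_1,\dots,M_n)$ of bounded operators, with action $p\cdot h=p(M_1,\dots,M_n)h$. The quotient of $\mathcal{H}$ by a submodule $\mathcal{S}$ (closed jointly invariant subspace) is identified with $\mathcal{S}^\perp$ with operators $P_{\mathcal{S}^\perp}M_i|_{\mathcal{S}^\perp}$. $\mathcal{H}\otimes\mathcal{E}$ carries the operators $M_i\otimes I_{\mathcal{E}}$. Two Hilbert modules are similar if there is a bounded invertible module map between them. $B_1^*(\Omega)$ is the class of Hilbert modules $\mathcal{H}$ over $\mathbb{C}[\boldsymbol{z}]$ such that for every $\boldsymbol{w}\in\Omega$: (i) the column operator $\mathcal{H}\to\mathcal{H}\otimes\mathbb{C}^n$, $h\mapsto((M_1-w_1)^*h,\dots,(M_n-w_n)^*h)$, has closed range; (ii) $E^*_{\mathcal{H}}(\boldsymbol{w}):=\bigcap_{i=1}^n\ker(M_i-w_i)^*$ is one-dimensional; and (iii) $\bigvee_{\boldsymbol{w}\in\Omega}E^*_{\mathcal{H}}(\boldsymbol{w})=\mathcal{H}$. For $\mathcal{H}\in B_1^*(\Omega)$ and Hilbert spaces $\mathcal{E},\mathcal{E}_*$, $\mathcal{M}_{\mathcal{B}(\mathcal{E},\mathcal{E}_* )}(\mathcal{H})$ consists of the holomorphic $\Theta:\Omega\to\mathcal{B}(\mathcal{E},\mathcal{E}_* )$ for which multiplication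 by $\Theta$ defines a bounded module map $M_\Theta:\mathcal{H}\otimes\mathcal{E}\to\mathcal{H}\otimes\mathcal{E}_*$; that is, $M_\Theta^*(k\otimes\eta)=k\otimes\Theta(\boldsymbol{w})^*\eta$ for all $\boldsymbol{w}\in\Omega$, $k\in E_{\mathcal{H}}^*(\boldsymbol{w})$, $\eta\in\mathcal{E}_*$. $\mathcal{M}(\mathcal{H})$ denotes the scalar multipliers ($\mathcal{E}=\mathcal{E}_*=\mathbb{C}$). $\Theta$ is left invertible if there is $\Psi\in\mathcal{M}_{\mathcal{B}(\mathcal{E}_*,\mathcal{E})}(\mathcal{H})$ with $\Psi(\boldsymbol{w})\Theta(\boldsymbol{w})=I_{\mathcal{E}}$ for all $\boldsymbol{w}\in\Omega$. Since $\mathcal{M}(\mathcal{H})\subseteq\mathcal{M}(\tilde{\mathcal{H}})$, $\Theta$ is also a multiplier for $\tilde{\mathcal{H}}$. *)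

theory Defs
  imports "HOL-Analysis.Analysis"
begin

section \<open>Complex Hilbert spaces\<close>

text \<open>The complex inner product is linear in the first argument. The underlying real
  inner product (hence norm and topology) is its real part.\<close>

class complex_inner = real_inner +
  fixes scaleC :: "complex \<Rightarrow> 'a \<Rightarrow> 'a" (infixr \<open>*\<^sub>C\<close> 75)
    and cinner :: "'a \<Rightarrow> 'a \<Rightarrow> complex"
  assumes scaleC_of_real: "complex_of_real r *\<^sub>C x = r *\<^sub>R x"
    and scaleC_add_right: "c *\<^sub>C (x + y) = c *\<^sub>C x + c *\<^sub>C y"
    and scaleC_add_left: "(c + d) *\<^sub>C x = c *\<^sub>C x + d *\<^sub>C x"
    and scaleC_scaleC: "c *\<^sub>C (d *\<^sub>C x) = (c * d) *\<^sub>C x"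
    and cinner_commute: "cinner x y = cnj (cinner y x)"
    and cinner_add_left: "cinner (x + y) z = cinner x z + cinner y z"
    and cinner_scaleC_left: "cinner (c *\<^sub>C x) y = c * cinner x y"
    and inner_eq_Re_cinner: "inner x y = Re (cinner x y)"

lemma scaleC_one: "1 *\<^sub>C x = (x :: 'a :: complex_inner)"
  using scaleC_of_real[of 1 x] by simp

global_interpretation complex_vector: vector_space "scaleC :: complex \<Rightarrow> 'a \<Rightarrow> 'a :: complex_inner"
  defines csubspace = complex_vector.subspace
    and cspan = complex_vector.span
    and cdim = complex_vector.dim
  by unfold_locales
    (simp_all add: scaleC_add_right scaleC_add_left scaleC_scaleC scaleC_one)

class separable_chilbert_space = complex_inner + complete_space + second_countable_topology

instantiation complex :: complex_inner
begin

definition scaleC_complex :: "complex \<Rightarrow> complex \<Rightarrow> complex"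
  where "scaleC_complex c x = c * x"

definition cinner_complex :: "complex \<Rightarrow> complex \<Rightarrow> complex"
  where "cinner_complex x y = x * cnj y"

instance
  by standard
    (simp_all add: scaleC_complex_def cinner_complex_def scaleR_conv_of_real algebra_simps
      inner_complex_def)

end

text \<open>The type \<open>'a ^ 'm\<close> is the orthogonal direct sum of copies of \<open>'a\<close> indexed by \<open>'m\<close>. Thus
  \<open>complex ^ 'm\<close> is \<open>\<complex>\<^sup>m\<close>, and \<open>'h ^ 'm\<close> is the Hilbert space tensor product of \<open>'h\<close> with
  \<open>\<complex>\<^sup>m\<close> by means of the elementary tensors defined below.\<close>

instantiation vec :: (complex_inner, finite) complex_inner
begin

definition scaleC_vec :: "complex \<Rightarrow> 'a ^ 'b \<Rightarrow> 'a ^ 'b"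
  where "scaleC_vec c x = (\<chi> i. c *\<^sub>C (x $ i))"

definition cinner_vec :: "'a ^ 'b \<Rightarrow> 'a ^ 'b \<Rightarrow> complex"
  where "cinner_vec x y = (\<Sum>i\<in>UNIV. cinner (x $ i) (y $ i))"

instance
proof
  fix x y z :: "'a ^ 'b" and c d :: complex and r :: real
  show "complex_of_real r *\<^sub>C x = r *\<^sub>R x"
    by (simp add: scaleC_vec_def vec_eq_iff scaleC_of_real)
  show "c *\<^sub>C (x + y) = c *\<^sub>C x + c *\<^sub>C y"
    by (simp add: scaleC_vec_def vec_eq_iff scaleC_add_right)
  show "(c + d) *\<^sub>C x = c *\<^sub>C x + d *\<^sub>C x"
    by (simp add: scaleC_vec_def vec_eq_iff scaleC_add_left)
  show "c *\<^sub>C (d *\<^sub>C x) = (c * d) *\<^sub>C x"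
    by (simp add: scaleC_vec_def vec_eq_iff scaleC_scaleC)
  show "cinner x y = cnj (cinner y x)"
    unfolding cinner_vec_def cnj_sum by (rule sum.cong[OF refl], rule cinner_commute)
  show "cinner (x + y) z = cinner x z + cinner y z"
    by (simp add: cinner_vec_def cinner_add_left sum.distrib)
  show "cinner (c *\<^sub>C x) y = c * cinner x y"
    by (simp add: cinner_vec_def scaleC_vec_def cinner_scaleC_left sum_distrib_left)
  show "inner x y = Re (cinner x y)"
    by (simp add: cinner_vec_def inner_vec_def inner_eq_Re_cinner)
qed

end

definition tensor :: "'h :: complex_inner \<Rightarrow> complex ^ 'm \<Rightarrow> 'h ^ 'm" (infixr \<open>\<otimes>\<^sub>h\<close> 75)
  where "k \<otimes>\<^sub>h \<eta> = (\<chi> j. (\<eta> $ j) *\<^sub>C k)"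

lemma cinner_tensor:
  "cinner (h \<otimes>\<^sub>h \<xi>) (k \<otimes>\<^sub>h \<eta>) = cinner h k * cinner \<xi> \<eta>"
proof -
  have "cinner (a *\<^sub>C h) (b *\<^sub>C k) = cinner h k * (a * cnj b)" for a b
    by (subst cinner_scaleC_left, subst cinner_commute, subst cinner_scaleC_left)
      (simp add: cinner_commute[of h k])
  then show ?thesis
    by (simp add: tensor_def cinner_vec_def cinner_complex_def sum_distrib_left)
qed

lemma cspan_tensor: "cspan {k \<otimes>\<^sub>h \<eta> | k \<eta>. True} = (UNIV :: ('h :: complex_inner ^ 'm) set)"
proof -
  have "x \<in> cspan {k \<otimes>\<^sub>h \<eta> | k \<eta>. True}" for x :: "'h ^ 'm"
  proof -
    have "x = (\<Sum>j\<in>UNIV. (x $ j) \<otimes>\<^sub>h axis j 1)"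
      by (simp add: vec_eq_iff tensor_def axis_def if_distrib[of "\<lambda>c. c *\<^sub>C _"] scaleC_one
          cong: if_cong)
    also have "\<dots> \<in> cspan {k \<otimes>\<^sub>h \<eta> | k \<eta>. True}"
      by (intro complex_vector.span_sum complex_vector.span_base) blast
    finally show ?thesis .
  qed
  then show ?thesis by blast
qed

section \<open>Operators\<close>

definition bounded_clinear :: "('a :: complex_inner \<Rightarrow> 'b :: complex_inner) \<Rightarrow> bool"
  where "bounded_clinear T \<longleftrightarrow> bounded_linear T \<and> (\<forall>c x. T (c *\<^sub>C x) = c *\<^sub>C T x)"

definition cadjoint ::
    "('a :: complex_inner \<Rightarrow> 'b :: complex_inner) \<Rightarrow> 'b \<Rightarrow> 'a"
  where "cadjoint T = (THE T'. \<forall>x y. cinner (T x) y = cinner x (T' y))"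

definition orth_complement :: "'a :: complex_inner set \<Rightarrow> 'a set"
  where "orth_complement S = {x. \<forall>s\<in>S. cinner x s = 0}"

definition orth_projection :: "'a :: complex_inner set \<Rightarrow> 'a \<Rightarrow> 'a"
  where "orth_projection V x = (THE y. y \<in> V \<and> x - y \<in> orth_complement V)"

text \<open>Holomorphy on an open set: complex Frechet differentiability at every point.
  For \<open>complex ^ 'p ^ 'q\<close>, the space of \<open>q \<times> p\<close> matrices, this refers to the
  Hilbert-Schmidt norm, which is equivalent to the operator norm.\<close>

definition holomorphic_map_on ::
    "('a :: complex_inner \<Rightarrow> 'b :: complex_inner) \<Rightarrow> 'a set \<Rightarrow> bool"
  where "holomorphic_map_on f \<Omega> \<longleftrightarrow>
    (\<forall>w\<in>\<Omega>. \<exists>D. bounded_clinear D \<and> (f has_derivative D) (at w within \<Omega>))"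

section \<open>Hilbert modules\<close>

text \<open>A Hilbert module over \<open>\<complex>[z\<^sub>1, \<dots>, z\<^sub>n]\<close> is given by the tuple of multiplications by the
  coordinates, which determines the action of every polynomial; in particular a map is a
  module map iff it intertwines these tuples.\<close>

definition hilbert_module :: "('n \<Rightarrow> 'h :: separable_chilbert_space \<Rightarrow> 'h) \<Rightarrow> bool"
  where "hilbert_module M \<longleftrightarrow>
    (\<forall>i. bounded_clinear (M i)) \<and> (\<forall>i j. M i \<circ> M j = M j \<circ> M i)"

definition ampliation ::
    "('n \<Rightarrow> 'h :: complex_inner \<Rightarrow> 'h) \<Rightarrow> 'n \<Rightarrow> 'h ^ 'm \<Rightarrow> 'h ^ 'm"
  where "ampliation M i x = (\<chi> j. M i (x $ j))"

lemma ampliation_tensor: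
  assumes "bounded_clinear (M i)"
  shows "ampliation M i (k \<otimes>\<^sub>h \<eta>) = M i k \<otimes>\<^sub>h \<eta>"
  using assms by (simp add: ampliation_def tensor_def bounded_clinear_def)

text \<open>Quotient modules live on closed subspaces, so a module that need not occupy a whole type
  is represented by its carrier and a tuple of operators that only matter on that carrier.\<close>

type_synonym ('n, 'a) module_on = "'a set \<times> ('n \<Rightarrow> 'a \<Rightarrow> 'a)"

definition full_module :: "('n \<Rightarrow> 'a \<Rightarrow> 'a) \<Rightarrow> ('n, 'a) module_on"
  where "full_module A = (UNIV, A)"

definition quotient_module ::
    "('n \<Rightarrow> 'a :: complex_inner \<Rightarrow> 'a) \<Rightarrow> 'a set \<Rightarrow> ('n, 'a) module_on"
  where "quotient_module A S =
    (orth_complement S, \<lambda>i x. orth_projection (orth_complement S) (A i x))"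

definition bounded_clinear_between ::
    "'a :: complex_inner set \<Rightarrow> 'b :: complex_inner set \<Rightarrow> ('a \<Rightarrow> 'b) \<Rightarrow> bool"
  where "bounded_clinear_between S T X \<longleftrightarrow>
    X ` S \<subseteq> T \<and>
    (\<forall>x\<in>S. \<forall>y\<in>S. X (x + y) = X x + X y) \<and>
    (\<forall>c. \<forall>x\<in>S. X (c *\<^sub>C x) = c *\<^sub>C X x) \<and>
    (\<exists>K. \<forall>x\<in>S. norm (X x) \<le> K * norm x)"

definition similar_modules ::
    "('n, 'a :: complex_inner) module_on \<Rightarrow> ('n, 'b :: complex_inner) module_on \<Rightarrow> bool"
  where "similar_modules \<A> \<B> \<longleftrightarrow>
    (\<exists>X Y. bounded_clinear_between (fst \<A>) (fst \<B>) X \<and>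
      bounded_clinear_between (fst \<B>) (fst \<A>) Y \<and>
      (\<forall>x\<in>fst \<A>. Y (X x) = x) \<and> (\<forall>y\<in>fst \<B>. X (Y y) = y) \<and>
      (\<forall>i. \<forall>x\<in>fst \<A>. X (snd \<A> i x) = snd \<B> i (X x)))"

section \<open>The class \<open>B\<^sub>1\<^sup>*(\<Omega>)\<close>\<close>

definition shift_adjoint ::
    "('n::finite \<Rightarrow> 'h :: complex_inner \<Rightarrow> 'h) \<Rightarrow> complex ^ 'n \<Rightarrow> 'n \<Rightarrow> 'h \<Rightarrow> 'h"
  where "shift_adjoint M w i = cadjoint (\<lambda>x. M i x - (w $ i) *\<^sub>C x)"

definition joint_eigenspace ::
    "('n::finite \<Rightarrow> 'h :: complex_inner \<Rightarrow> 'h) \<Rightarrow> complex ^ 'n \<Rightarrow> 'h set"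
  where "joint_eigenspace M w = (\<Inter>i. {h. shift_adjoint M w i h = 0})"

definition B1_star ::
    "(complex ^ 'n) set \<Rightarrow> ('n::finite \<Rightarrow> 'h :: separable_chilbert_space \<Rightarrow> 'h) \<Rightarrow> bool"
  where "B1_star \<Omega> M \<longleftrightarrow>
    hilbert_module M \<and>
    (\<forall>w\<in>\<Omega>. closed (range (\<lambda>h. (\<chi> i. shift_adjoint M w i h) :: 'h ^ 'n))) \<and>
    (\<forall>w\<in>\<Omega>. cdim (joint_eigenspace M w) = 1) \<and>
    closure (cspan (\<Union>w\<in>\<Omega>. joint_eigenspace M w)) = UNIV"

section \<open>Multipliers\<close>

text \<open>\<open>\<B>(\<complex>\<^sup>p, \<complex>\<^sup>q)\<close> is the type \<open>complex ^ 'p ^ 'q\<close> of \<open>q \<times> p\<close> matrices, a matrix \<open>A\<close> acting by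
  \<open>(*v) A\<close>. Only the values of a symbol on \<open>\<Omega>\<close> matter.\<close>

definition is_multiplication_operator ::
    "(complex ^ 'n) set \<Rightarrow> ('n::finite \<Rightarrow> 'h :: separable_chilbert_space \<Rightarrow> 'h) \<Rightarrow>
     (complex ^ 'n \<Rightarrow> complex ^ 'p ^ 'q) \<Rightarrow> ('h ^ 'p \<Rightarrow> 'h ^ 'q) \<Rightarrow> bool"
  where "is_multiplication_operator \<Omega> M \<Theta> T \<longleftrightarrow>
    bounded_clinear T \<and>
    (\<forall>i x. T (ampliation M i x) = ampliation M i (T x)) \<and>
    (\<forall>w\<in>\<Omega>. \<forall>k\<in>joint_eigenspace M w. \<forall>\<eta>.
      cadjoint T (k \<otimes>\<^sub>h \<eta>) = k \<otimes>\<^sub>h cadjoint ((*v) (\<Theta> w)) \<eta>)"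

definition multipliers ::
    "(complex ^ 'n) set \<Rightarrow> ('n::finite \<Rightarrow> 'h :: separable_chilbert_space \<Rightarrow> 'h) \<Rightarrow>
     (complex ^ 'n \<Rightarrow> complex ^ 'p ^ 'q) set"
  where "multipliers \<Omega> M =
    {\<Theta>. holomorphic_map_on \<Theta> \<Omega> \<and> (\<exists>T. is_multiplication_operator \<Omega> M \<Theta> T)}"

text \<open>The operator \<open>M\<^sub>\<Theta>\<close>; it is unique if the joint eigenspaces span a dense subspace.\<close>

definition multiplication_operator ::
    "(complex ^ 'n) set \<Rightarrow> ('n::finite \<Rightarrow> 'h :: separable_chilbert_space \<Rightarrow> 'h) \<Rightarrow>
     (complex ^ 'n \<Rightarrow> complex ^ 'p ^ 'q) \<Rightarrow> 'h ^ 'p \<Rightarrow> 'h ^ 'q"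
  where "multiplication_operator \<Omega> M \<Theta> = (THE T. is_multiplication_operator \<Omega> M \<Theta> T)"

text \<open>The case of one-dimensional coefficient spaces; \<open>mat c\<close> is the \<open>1 \<times> 1\<close> matrix \<open>c\<close>.\<close>

definition scalar_multipliers ::
    "(complex ^ 'n) set \<Rightarrow> ('n::finite \<Rightarrow> 'h :: separable_chilbert_space \<Rightarrow> 'h) \<Rightarrow>
     (complex ^ 'n \<Rightarrow> complex) set"
  where "scalar_multipliers \<Omega> M =
    {\<phi>. (\<lambda>w. mat (\<phi> w) :: complex ^ 1 ^ 1) \<in> multipliers \<Omega> M}"

definition left_invertible_multiplier ::
    "(complex ^ 'n) set \<Rightarrow> ('n::finite \<Rightarrow> 'h :: separable_chilbert_space \<Rightarrow> 'h) \<Rightarrow>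
     (complex ^ 'n \<Rightarrow> complex ^ 'p ^ 'q) \<Rightarrow> bool"
  where "left_invertible_multiplier \<Omega> M \<Theta> \<longleftrightarrow>
    (\<exists>\<Psi> \<in> multipliers \<Omega> M. \<forall>w\<in>\<Omega>. \<Psi> w ** \<Theta> w = mat 1)"

definition multiplier_quotient ::
    "(complex ^ 'n) set \<Rightarrow> ('n::finite \<Rightarrow> 'h :: separable_chilbert_space \<Rightarrow> 'h) \<Rightarrow>
     (complex ^ 'n \<Rightarrow> complex ^ 'p ^ 'q) \<Rightarrow> ('n, 'h ^ 'q) module_on"
  where "multiplier_quotient \<Omega> M \<Theta> =
    quotient_module (ampliation M) (range (multiplication_operator \<Omega> M \<Theta>))"

end

theory Submission
  imports Defs
begin

text \<open>
  The left inverse \<open>L = M\<^sub>\<Psi>\<close> of \<open>T = M\<^sub>\<Theta>\<close> makes \<open>T L\<close> an idempotent module map, so the quotient by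
  \<open>range T\<close> is a direct summand. A similarity between the quotient and \<open>\<H> \<otimes> \<complex>\<^sup>r\<close> is therefore the
  same as a pair of module maps \<open>A\<close>, \<open>B\<close> between the free modules with \<open>A B = I\<close>,
  \<open>B A = I - T L\<close> and \<open>A T = 0\<close>. Module maps between free modules are multiplication operators
  whose matrix entries are scalar multipliers, and the three identities hold iff they hold
  pointwise for the symbols. Since the entries are also multipliers of the second module, the
  same symbols define \<open>A\<close>, \<open>B\<close> there.

  What needs the closed range condition is that the symbol of a module map \<open>X\<close> is holomorphic.
  Let \<open>D\<close> be the column operator at \<open>w\<^sub>0\<close>, \<open>Q\<close> a bounded generalized inverse of \<open>D\<close>, and \<open>k\<^sub>0\<close> a
  unit eigenvector at \<open>w\<^sub>0\<close>. The eigenvector \<open>k = k\<^sub>0 + v\<close> at \<open>w\<close> with \<open>v \<bottom> k\<^sub>0\<close> satisfies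
  \<open>v = Q (D k)\<close>, where \<open>D k\<close> has the components \<open>cnj (w\<^sub>i - w\<^sub>0\<^sub>i) k\<close>; so \<open>v\<close> is conjugate linear in \<open>w - w\<^sub>0\<close>
  up to second order, and the symbol at \<open>w\<close> is \<open>\<langle>X k\<^sub>0, k\<rangle>\<close>.
\<close>

section \<open>Complex Hilbert spaces\<close>

instance separable_chilbert_space \<subseteq> banach ..

section \<open>Algebra of the complex inner product\<close>

lemma cinner_add_right: "cinner x (y + z) = cinner x y + cinner x z"
  by (metis cinner_commute cinner_add_left complex_cnj_add)

lemma cinner_scaleC_right: "cinner x (c *\<^sub>C y) = cnj c * cinner x y"
  by (metis cinner_commute cinner_scaleC_left complex_cnj_mult)

lemma cinner_zero_left [simp]: "cinner 0 x = 0"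
  using cinner_add_left[of 0 0 x] by simp

lemma cinner_zero_right [simp]: "cinner x 0 = 0"
  using cinner_add_right[of x 0 0] by simp

lemma cinner_diff_left: "cinner (x - y) z = cinner x z - cinner y z"
  using cinner_add_left[of "x - y" y z] by simp

lemma cinner_diff_right: "cinner z (x - y) = cinner z x - cinner z y"
  using cinner_add_right[of z "x - y" y] by simp

lemma cinner_sum_left: "cinner (\<Sum>i\<in>A. f i) y = (\<Sum>i\<in>A. cinner (f i) y)"
  by (induction A rule: infinite_finite_induct) (simp_all add: cinner_add_left)

lemma cinner_self: "cinner x x = complex_of_real ((norm x)\<^sup>2)"
proof -
  have "Im (cinner x x) = 0"
    using cinner_commute[of x x] by (simp add: complex_eq_iff)
  then show ?thesis
    by (simp add: complex_eq_iff power2_norm_eq_inner inner_eq_Re_cinner)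
qed

lemma cinner_self_eq_zero [simp]: "cinner x x = 0 \<longleftrightarrow> x = 0"
  by (simp add: cinner_self)

lemma cinner_eqI: "(\<And>z. cinner z x = cinner z y) \<Longrightarrow> x = y"
  using cinner_self_eq_zero[of "x - y"] by (simp add: cinner_diff_right)

lemma norm_scaleC [simp]: "norm (c *\<^sub>C x) = cmod c * norm x"
proof -
  have "complex_of_real ((norm (c *\<^sub>C x))\<^sup>2) = complex_of_real ((cmod c * norm x)\<^sup>2)"
    unfolding cinner_self[symmetric] cinner_scaleC_left cinner_scaleC_right
    by (simp add: cinner_self complex_norm_square power_mult_distrib del: of_real_power)
  then have "(norm (c *\<^sub>C x))\<^sup>2 = (cmod c * norm x)\<^sup>2"
    by (simp only: of_real_eq_iff)
  then show ?thesis by simp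
qed

text \<open>The unimodular factor \<open>c\<close> rotates the inner product onto the nonnegative
  real axis, where the real Cauchy-Schwarz inequality applies.\<close>

lemma norm_cinner_le: "cmod (cinner x y) \<le> norm x * norm y"
proof -
  define c where "c = (if cinner x y = 0 then 1 else cnj (cinner x y) / cmod (cinner x y))"
  have c: "cmod c = 1" by (simp add: c_def norm_divide)
  have "c * cinner x y = cmod (cinner x y)"
    by (simp add: c_def complex_norm_square[symmetric] mult.commute power2_eq_square)
  then have "cmod (cinner x y) = inner (c *\<^sub>C x) y"
    by (simp add: inner_eq_Re_cinner cinner_scaleC_left)
  also have "\<dots> \<le> norm (c *\<^sub>C x) * norm y" by (rule norm_cauchy_schwarz)
  finally show ?thesis by (simp add: c)
qed

section \<open>Bounded complex-linear maps and coordinates\<close>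

lemma bounded_clinearI:
  assumes "\<And>x y. T (x + y) = T x + T y" "\<And>c x. T (c *\<^sub>C x) = c *\<^sub>C T x"
    and "\<And>x. norm (T x) \<le> norm x * K"
  shows "bounded_clinear T"
  unfolding bounded_clinear_def
  using assms(2)[of "complex_of_real r" for r]
  by (auto intro!: bounded_linear_intro[of _ K] assms simp: scaleC_of_real)

lemma bounded_clinearD:
  assumes "bounded_clinear T"
  shows "bounded_linear T" "T (x + y) = T x + T y" "T (x - y) = T x - T y"
    "T (c *\<^sub>C x) = c *\<^sub>C T x" "T 0 = 0"
  using assms by (auto simp: bounded_clinear_def linear_simps)

lemma bounded_clinear_image_sum: "bounded_clinear T \<Longrightarrow> T (\<Sum>i\<in>A. f i) = (\<Sum>i\<in>A. T (f i))"
  by (induction A rule: infinite_finite_induct) (simp_all add: bounded_clinearD)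

lemma bounded_clinear_compose:
  "bounded_clinear S \<Longrightarrow> bounded_clinear T \<Longrightarrow> bounded_clinear (\<lambda>x. S (T x))"
  unfolding bounded_clinear_def using bounded_linear_compose[of S T] by simp

lemma bounded_clinear_add:
  "bounded_clinear S \<Longrightarrow> bounded_clinear T \<Longrightarrow> bounded_clinear (\<lambda>x. S x + T x)"
  unfolding bounded_clinear_def using bounded_linear_add[of S T] by (simp add: scaleC_add_right)

lemma bounded_clinear_diff:
  "bounded_clinear S \<Longrightarrow> bounded_clinear T \<Longrightarrow> bounded_clinear (\<lambda>x. S x - T x)"
  unfolding bounded_clinear_def using bounded_linear_sub[of S T]
  by (simp add: complex_vector.scale_right_diff_distrib)

lemma bounded_clinear_id: "bounded_clinear (\<lambda>x. x)"
  by (rule bounded_clinearI[of _ 1]) simp_all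

lemma bounded_clinear_scaleC: "bounded_clinear (\<lambda>x. c *\<^sub>C x)"
  by (rule bounded_clinearI[of _ "cmod c"])
    (simp_all add: scaleC_add_right scaleC_scaleC mult.commute)

lemma bounded_clinear_zero: "bounded_clinear (\<lambda>x. 0)"
  by (rule bounded_clinearI[of _ 0]) simp_all

lemma bounded_clinear_sum:
  assumes "\<And>i. i \<in> A \<Longrightarrow> bounded_clinear (T i)"
  shows "bounded_clinear (\<lambda>x. \<Sum>i\<in>A. T i x)"
  using assms
  by (induction A rule: infinite_finite_induct)
    (simp_all add: bounded_clinear_add bounded_clinear_zero)

lemma bounded_clinear_cinner_left: "bounded_clinear (\<lambda>x. cinner x y)"
  by (rule bounded_clinearI[of _ "norm y"])
    (simp_all add: cinner_add_left cinner_scaleC_left norm_cinner_le scaleC_complex_def)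

lemma scaleC_vec_nth [simp]: "(c *\<^sub>C x) $ i = c *\<^sub>C (x $ i)"
  by (simp add: scaleC_vec_def)

lemma bounded_clinear_vec_nth: "bounded_clinear (\<lambda>x. x $ i)"
  by (rule bounded_clinearI[of _ 1]) (simp_all add: Finite_Cartesian_Product.norm_nth_le)

lemma bounded_clinear_axis: "bounded_clinear (axis i)"
  by (rule bounded_clinearI[of _ 1]) (simp_all add: axis_def vec_eq_iff norm_eq_sqrt_inner inner_axis_axis[unfolded axis_def])

lemma bounded_clinear_axis_nth:
  assumes "bounded_clinear T"
  shows "bounded_clinear (\<lambda>x. T (axis j x) $ i)"
  using bounded_clinear_compose[of "\<lambda>x. x $ i" "\<lambda>x. T (axis j x)"]
    bounded_clinear_compose[of T "axis j"] bounded_clinear_vec_nth bounded_clinear_axis assms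
  by blast

lemma bounded_clinear_vec_lambda:
  assumes "\<And>i. bounded_clinear (T i)"
  shows "bounded_clinear (\<lambda>x. \<chi> i. T i x)"
proof -
  have "(\<lambda>x. \<chi> i. T i x) = (\<lambda>x. \<Sum>i\<in>UNIV. axis i (T i x))"
    by (rule ext) (simp add: vec_eq_iff axis_def if_distrib cong: if_cong)
  then show ?thesis
    by (simp add: bounded_clinear_sum bounded_clinear_compose[OF bounded_clinear_axis] assms)
qed

lemma vec_sum_axis: "x = (\<Sum>j\<in>UNIV. axis j (x $ j))"
  by (simp add: vec_eq_iff axis_def if_distrib cong: if_cong)

section \<open>Orthogonal projections in Hilbert space\<close>

text \<open>A minimizing sequence is Cauchy by the parallelogram law, and its limit stays in
  \<open>V\<close>.\<close>

lemma closed_subspace_nearest_point: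
  fixes V :: "'a :: {real_inner, banach} set"
  assumes "closed V" "subspace V"
  shows "\<exists>y\<in>V. \<forall>v\<in>V. norm (x - y) \<le> norm (x - v)"
proof -
  define d where "d = infdist x V"
  have ne: "V \<noteq> {}" using assms(2) subspace_0 by auto
  have d: "d \<le> norm (x - v)" if "v \<in> V" for v
    using infdist_le[OF that, of x] by (simp add: d_def dist_norm)
  have d0: "0 \<le> d" by (simp add: d_def infdist_nonneg)
  have "\<exists>v\<in>V. norm (x - v) < d + e" if "e > 0" for e
  proof (rule ccontr)
    assume "\<not> ?thesis"
    then have "d + e \<le> (INF v\<in>V. dist x v)"
      by (intro cINF_greatest[OF ne]) (auto simp: dist_norm not_less)
    then show False using that ne by (simp add: d_def infdist_notempty)
  qed
  then have "\<exists>v\<in>V. norm (x - v) < d + inverse (real (Suc n))" for n by simp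
  then obtain y where y: "\<And>n. y n \<in> V" "\<And>n. norm (x - y n) < d + inverse (real (Suc n))"
    by metis
  \<comment> \<open>The midpoint of \<open>y m\<close> and \<open>y n\<close> lies in
    \<open>V\<close>, so its distance to \<open>x\<close> is at least \<open>d\<close>. The
    parallelogram law then bounds the square by \<open>4 * (d + e)\<^sup>2 - 4 * d\<^sup>2\<close>,
    and \<open>e \<le> 1\<close> makes this linear in \<open>e\<close>.\<close>
  have diff: "(norm (y m - y n))\<^sup>2 \<le> (8 * d + 4) * e"
    if "inverse (real (Suc m)) \<le> e" "inverse (real (Suc n)) \<le> e" "e \<le> 1" for m n e
  proof -
    have par: "(norm (y m - y n))\<^sup>2 = 2 * (norm (x - y m))\<^sup>2 + 2 * (norm (x - y n))\<^sup>2
        - 4 * (norm (x - (1/2) *\<^sub>R (y m + y n)))\<^sup>2"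
      by (simp add: power2_norm_eq_inner algebra_simps inner_commute)
    have "(1/2) *\<^sub>R (y m + y n) \<in> V"
      by (intro subspace_scale subspace_add y assms)
    then have "d\<^sup>2 \<le> (norm (x - (1/2) *\<^sub>R (y m + y n)))\<^sup>2"
      using d d0 by (intro power_mono) auto
    moreover have "(norm (x - y k))\<^sup>2 \<le> (d + e)\<^sup>2" if "inverse (real (Suc k)) \<le> e" for k
      using y(2)[of k] that by (intro power_mono) auto
    ultimately have "(norm (y m - y n))\<^sup>2 \<le> 4 * (d + e)\<^sup>2 - 4 * d\<^sup>2"
      using par that(1,2) by (smt (verit))
    also have "\<dots> = (8 * d + 4 * e) * e" by (simp add: power2_eq_square algebra_simps)
    also have "\<dots> \<le> (8 * d + 4) * e"
    proof (rule mult_right_mono)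
      show "0 \<le> e" using that(1) order_trans[of 0 "inverse (real (Suc m))" e] by simp
    qed (use that in simp)
    finally show ?thesis .
  qed
  have "Cauchy y"
  proof (rule metric_CauchyI)
    fix e :: real assume "e > 0"
    \<comment> \<open>The factor 2 in the denominator leaves room for a strict inequality.\<close>
    define \<delta> where "\<delta> = min 1 (e\<^sup>2 / (2 * (8 * d + 4)))"
    have \<delta>: "\<delta> > 0" "\<delta> \<le> 1" "(8 * d + 4) * \<delta> < e\<^sup>2"
    proof -
      show "\<delta> > 0" "\<delta> \<le> 1" using \<open>e > 0\<close> d0 by (auto simp: \<delta>_def)
      have "(8 * d + 4) * \<delta> \<le> (8 * d + 4) * (e\<^sup>2 / (2 * (8 * d + 4)))"
        using d0 by (intro mult_left_mono) (auto simp: \<delta>_def)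
      also have "\<dots> = e\<^sup>2 / 2" using d0 by (simp add: field_simps)
      also have "\<dots> < e\<^sup>2" using \<open>e > 0\<close> by simp
      finally show "(8 * d + 4) * \<delta> < e\<^sup>2" .
    qed
    obtain N where N: "inverse (real (Suc N)) < \<delta>" using reals_Archimedean \<delta>(1) by blast
    have le: "inverse (real (Suc k)) \<le> \<delta>" if "k \<ge> N" for k
    proof -
      have "inverse (real (Suc k)) \<le> inverse (real (Suc N))"
        using that by (intro le_imp_inverse_le) auto
      with N show ?thesis by linarith
    qed
    have "dist (y m) (y n) < e" if "m \<ge> N" "n \<ge> N" for m n
      using diff[OF le[OF that(1)] le[OF that(2)] \<delta>(2)] \<delta>(3) \<open>e > 0\<close>
      by (metis dist_norm le_less_trans power2_less_imp_less less_imp_le)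
    then show "\<exists>N. \<forall>m\<ge>N. \<forall>n\<ge>N. dist (y m) (y n) < e" by blast
  qed
  then obtain l where l: "y \<longlonglongrightarrow> l" using Cauchy_convergent convergent_def by blast
  have "l \<in> V" using closed_sequentially[OF assms(1) _ l] y by blast
  moreover have "norm (x - l) \<le> d"
  proof (rule LIMSEQ_le)
    show "(\<lambda>n. norm (x - y n)) \<longlonglongrightarrow> norm (x - l)" by (intro tendsto_intros l)
    show "(\<lambda>n. d + inverse (real (Suc n))) \<longlonglongrightarrow> d"
      using tendsto_add[OF tendsto_const LIMSEQ_inverse_real_of_nat, of d] by simp
  qed (use y(2) less_imp_le in blast)
  ultimately show ?thesis using d by force
qed

text \<open>First-order optimality: moving the nearest point along \<open>v\<close> by the optimal
  step \<open>t\<close> lowers the squared distance by \<open>t * inner (x - y) v\<close>, which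
  therefore cannot be positive.\<close>

lemma closed_subspace_projection:
  fixes V :: "'a :: {real_inner, banach} set"
  assumes "closed V" "subspace V"
  shows "\<exists>y\<in>V. \<forall>v\<in>V. inner (x - y) v = 0"
proof -
  obtain y where y: "y \<in> V" "\<And>v. v \<in> V \<Longrightarrow> norm (x - y) \<le> norm (x - v)"
    using closed_subspace_nearest_point[OF assms] by blast
  have "inner (x - y) v = 0" if v: "v \<in> V" for v
  proof (cases "v = 0")
    case False
    define t where "t = inner (x - y) v / inner v v"
    have "(norm (x - y))\<^sup>2 \<le> (norm (x - (y + t *\<^sub>R v)))\<^sup>2"
      by (intro power_mono y subspace_add subspace_scale assms v) simp
    also have "\<dots> = (norm (x - y))\<^sup>2 - 2 * t * inner (x - y) v + t * (t * inner v v)"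
      by (simp add: power2_norm_eq_inner algebra_simps inner_commute)
    also have "t * inner v v = inner (x - y) v"
      using False by (simp add: t_def)
    finally have "t * inner (x - y) v \<le> 0" by simp
    then have "(inner (x - y) v)\<^sup>2 / inner v v \<le> 0" by (simp add: t_def power2_eq_square)
    moreover have "inner v v > 0" using False by simp
    ultimately show ?thesis
      by (simp add: divide_le_0_iff)
  qed simp
  with y show ?thesis by blast
qed

lemma csubspace_imp_subspace: "csubspace V \<Longrightarrow> subspace V"
  unfolding complex_vector.subspace_def subspace_def by (metis scaleC_of_real)

text \<open>Real orthogonality to \<open>v\<close> kills the real part of the complex inner product,
  real orthogonality to \<open>\<i> *\<^sub>C v\<close> the imaginary part.\<close>

lemma closed_csubspace_projection:
  fixes V :: "'a :: {complex_inner, banach} set"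
  assumes "closed V" "csubspace V"
  shows "\<exists>y\<in>V. x - y \<in> orth_complement V"
proof -
  obtain y where y: "y \<in> V" "\<And>v. v \<in> V \<Longrightarrow> inner (x - y) v = 0"
    using closed_subspace_projection[OF assms(1) csubspace_imp_subspace[OF assms(2)]] by blast
  have "cinner (x - y) v = 0" if "v \<in> V" for v
  proof -
    have "\<i> *\<^sub>C v \<in> V" using that assms(2) by (simp add: complex_vector.subspace_scale)
    then show ?thesis
      using y(2)[OF that] y(2)[of "\<i> *\<^sub>C v"]
      by (simp add: inner_eq_Re_cinner cinner_scaleC_right complex_eq_iff)
  qed
  with y(1) show ?thesis unfolding orth_complement_def by blast
qed

lemma csubspace_orth_complement: "csubspace (orth_complement S)"
  by (auto simp: complex_vector.subspace_def orth_complement_def cinner_add_left cinner_scaleC_left)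

lemma closed_orth_complement: "closed (orth_complement S)"
proof -
  have "orth_complement S = (\<Inter>s\<in>S. (\<lambda>x. cinner x s) -` {0})"
    by (auto simp: orth_complement_def)
  moreover have "closed ((\<lambda>x. cinner x s) -` {0})" for s :: 'a
    by (intro continuous_closed_vimage closed_singleton
        linear_continuous_at bounded_clinearD(1) bounded_clinear_cinner_left)
  ultimately show ?thesis by auto
qed

lemma orth_projection_eq:
  assumes "csubspace V" "y \<in> V" "x - y \<in> orth_complement V"
  shows "orth_projection V x = y"
  unfolding orth_projection_def
proof (rule the_equality)
  fix z assume z: "z \<in> V \<and> x - z \<in> orth_complement V"
  have "y - z \<in> V" using assms(1,2) z by (simp add: complex_vector.subspace_diff)
  moreover have "y - z \<in> orth_complement V"
    using complex_vector.subspace_diff[OF csubspace_orth_complement, of "x - z" V "x - y"] z assms(3)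
    by simp
  ultimately have "cinner (y - z) (y - z) = 0" unfolding orth_complement_def by blast
  then show "z = y" by simp
qed (use assms in simp)

lemma orth_projection_ident: "csubspace V \<Longrightarrow> x \<in> V \<Longrightarrow> orth_projection V x = x"
  by (rule orth_projection_eq) (simp_all add: orth_complement_def)

lemma orth_projection_orth_complement_zero:
  assumes "s \<in> S"
  shows "orth_projection (orth_complement S) s = 0"
proof (rule orth_projection_eq[OF csubspace_orth_complement])
  have "cinner s y = 0" if "y \<in> orth_complement S" for y
    using that assms cinner_commute[of s y] by (simp add: orth_complement_def)
  then show "s - 0 \<in> orth_complement (orth_complement S)" by (simp add: orth_complement_def)
qed (simp add: orth_complement_def)

context
  fixes V :: "'a :: {complex_inner, banach} set"
  assumes V: "closed V" "csubspace V"
begin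

lemma orth_projection_in: "orth_projection V x \<in> V"
  and orth_projection_orth: "x - orth_projection V x \<in> orth_complement V"
  using closed_csubspace_projection[OF V, of x] orth_projection_eq[OF V(2), of _ x] by metis+

lemma bounded_clinear_orth_projection: "bounded_clinear (orth_projection V)"
proof (rule bounded_clinearI[of _ 1])
  fix x y :: 'a and c
  let ?P = "orth_projection V"
  show "?P (x + y) = ?P x + ?P y"
  proof (rule orth_projection_eq[OF V(2)])
    show "?P x + ?P y \<in> V" by (intro complex_vector.subspace_add V orth_projection_in)
    have "(x - ?P x) + (y - ?P y) \<in> orth_complement V"
      by (intro complex_vector.subspace_add csubspace_orth_complement orth_projection_orth)
    then show "x + y - (?P x + ?P y) \<in> orth_complement V" by (simp add: algebra_simps)
  qed
  show "?P (c *\<^sub>C x) = c *\<^sub>C ?P x"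
  proof (rule orth_projection_eq[OF V(2)])
    show "c *\<^sub>C ?P x \<in> V" by (intro complex_vector.subspace_scale V orth_projection_in)
    have "c *\<^sub>C (x - ?P x) \<in> orth_complement V"
      by (intro complex_vector.subspace_scale csubspace_orth_complement orth_projection_orth)
    then show "c *\<^sub>C x - c *\<^sub>C ?P x \<in> orth_complement V"
      by (simp add: complex_vector.scale_right_diff_distrib)
  qed
  have "cinner (x - ?P x) (?P x) = 0"
    using orth_projection_orth[of x] orth_projection_in[of x] by (simp add: orth_complement_def)
  then have "inner (x - ?P x) (?P x) = 0" by (simp add: inner_eq_Re_cinner)
  then have "(norm (?P x))\<^sup>2 = inner x (?P x)"
    by (simp add: inner_diff_left power2_norm_eq_inner)
  also have "\<dots> \<le> norm x * norm (?P x)" by (rule norm_cauchy_schwarz)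
  finally show "norm (?P x) \<le> norm x * 1"
    by (cases "?P x = 0") (simp_all add: power2_eq_square)
qed

end

text \<open>The projection onto the complement is the identity minus the projection onto
  \<open>V\<close>. For quotient modules: a vector and its representative differ by an element of
  the submodule.\<close>

lemma diff_orth_projection_orth_complement_in:
  fixes V :: "'a :: {complex_inner, banach} set"
  assumes "closed V" "csubspace V"
  shows "x - orth_projection (orth_complement V) x \<in> V"
proof -
  have "orth_projection (orth_complement V) x = x - orth_projection V x"
  proof (rule orth_projection_eq[OF csubspace_orth_complement orth_projection_orth[OF assms]])
    have "cinner (orth_projection V x) y = 0" if "y \<in> orth_complement V" for y
      using that orth_projection_in[OF assms, of x] cinner_commute[of "orth_projection V x" y]
      by (simp add: orth_complement_def)
    then show "x - (x - orth_projection V x) \<in> orth_complement (orth_complement V)"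
      by (simp add: orth_complement_def)
  qed
  then show ?thesis using orth_projection_in[OF assms, of x] by simp
qed

section \<open>Riesz representation and adjoints\<close>

text \<open>Take \<open>u\<close> orthogonal to the kernel of \<open>f\<close> with
  \<open>f u\<close> nonzero. Since \<open>x - (f x / f u) *\<^sub>C u\<close> lies in the kernel,
  its inner product with \<open>u\<close> vanishes, and this can be solved for
  \<open>f x\<close>.\<close>

lemma riesz_representation:
  fixes f :: "'a :: {complex_inner, banach} \<Rightarrow> complex"
  assumes "bounded_clinear f"
  shows "\<exists>h. \<forall>x. f x = cinner x h"
proof (cases "\<forall>x. f x = 0")
  case True
  then show ?thesis by (intro exI[of _ 0]) simp
next
  case False
  then obtain x0 where x0: "f x0 \<noteq> 0" by blast
  define V where "V = f -` {0}"
  have "closed V"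
    unfolding V_def by (intro continuous_closed_vimage closed_singleton
        linear_continuous_at bounded_clinearD(1) assms)
  moreover have "csubspace V"
    by (auto simp: V_def complex_vector.subspace_def bounded_clinearD[OF assms] scaleC_complex_def)
  ultimately obtain y where y: "y \<in> V" "x0 - y \<in> orth_complement V"
    using closed_csubspace_projection by blast
  define u where "u = x0 - y"
  have fu: "f u = f x0" using y(1) by (simp add: u_def V_def bounded_clinearD[OF assms])
  then have u: "u \<noteq> 0" using x0 bounded_clinearD(5)[OF assms] by auto
  have "f x = cinner x ((cnj (f u) / cinner u u) *\<^sub>C u)" for x
  proof -
    have "f (x - (f x / f u) *\<^sub>C u) = 0"
      using x0 fu by (simp add: bounded_clinearD[OF assms] scaleC_complex_def)
    then have "cinner u (x - (f x / f u) *\<^sub>C u) = 0"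
      using y(2) unfolding u_def orth_complement_def V_def by simp
    then have "cinner (x - (f x / f u) *\<^sub>C u) u = 0"
      by (subst cinner_commute) simp
    then show ?thesis
      using u x0 fu by (simp add: cinner_diff_left cinner_scaleC_left cinner_scaleC_right
          field_simps cinner_self)
  qed
  then show ?thesis by blast
qed

lemma cadjoint_eqI:
  assumes "\<And>x y. cinner (T x) y = cinner x (S y)"
  shows "cadjoint T = S"
  unfolding cadjoint_def
proof (rule the_equality)
  fix S' assume "\<forall>x y. cinner (T x) y = cinner x (S' y)"
  then have "cinner x (S' y) = cinner x (S y)" for x y using assms by metis
  then show "S' = S" by (metis ext cinner_eqI)
qed (use assms in blast)

text \<open>Riesz representation, applied for each \<open>y\<close>, produces the map that the
  definite description in \<open>cadjoint\<close> refers to.\<close>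

lemma cinner_cadjoint:
  fixes T :: "'a :: {complex_inner, banach} \<Rightarrow> 'b :: complex_inner"
  assumes "bounded_clinear T"
  shows "cinner x (cadjoint T y) = cinner (T x) y"
proof -
  have "\<forall>y. \<exists>h. \<forall>x. cinner (T x) y = cinner x h"
    by (intro allI riesz_representation bounded_clinear_compose[OF bounded_clinear_cinner_left] assms)
  then obtain S where "\<And>x y. cinner (T x) y = cinner x (S y)" by metis
  then show ?thesis using cadjoint_eqI[of T S] by metis
qed

lemma bounded_clinear_cadjoint:
  fixes T :: "'a :: {complex_inner, banach} \<Rightarrow> 'b :: complex_inner"
  assumes "bounded_clinear T"
  shows "bounded_clinear (cadjoint T)"
proof -
  note adj = cinner_cadjoint[OF assms]
  obtain K where K: "\<And>x. norm (T x) \<le> norm x * K" "0 \<le> K"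
    using bounded_linear.nonneg_bounded[OF bounded_clinearD(1)[OF assms]] by blast
  show ?thesis
  proof (rule bounded_clinearI[of _ K])
    show "cadjoint T (x + y) = cadjoint T x + cadjoint T y" for x y
      by (rule cinner_eqI) (simp add: adj cinner_add_right)
    show "cadjoint T (c *\<^sub>C x) = c *\<^sub>C cadjoint T x" for c x
      by (rule cinner_eqI) (simp add: adj cinner_scaleC_right)
    fix y
    let ?u = "cadjoint T y"
    have "(norm ?u)\<^sup>2 = cmod (cinner ?u ?u)" by (simp add: cinner_self norm_power)
    also have "\<dots> \<le> norm (T ?u) * norm y" unfolding adj by (rule norm_cinner_le)
    also have "\<dots> \<le> norm ?u * K * norm y" by (intro mult_right_mono K) simp
    finally have "norm ?u * norm ?u \<le> norm ?u * (norm y * K)"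
      by (simp add: power2_eq_square mult_ac)
    then show "norm ?u \<le> norm y * K"
      using K(2) by (cases "?u = 0") simp_all
  qed
qed

section \<open>Operators with closed range\<close>

text \<open>The Baire half of the open mapping theorem. The closed range is a complete metric space
  covered by the closures \<open>F n\<close> of images of balls, so some \<open>F n\<close> has
  interior relative to the range.\<close>

lemma closed_range_approximate_preimages:
  fixes T :: "'a :: real_normed_vector \<Rightarrow> 'b :: banach"
  assumes "bounded_linear T" "closed (range T)"
  shows "\<exists>C\<ge>0. \<forall>y\<in>range T. \<forall>\<epsilon>>0. \<exists>x. norm x \<le> C * norm y \<and> norm (y - T x) < \<epsilon>"
proof -
  interpret T: bounded_linear T by fact
  let ?X = "top_of_set (range T)"
  define F where "F n = closure (T ` cball 0 (real n))" for n :: nat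
  have F_sub: "F n \<subseteq> range T" for n
    unfolding F_def by (intro closure_minimal assms) blast
  have "\<exists>n. ?X interior_of (F n) \<noteq> {}"
  proof (rule ccontr)
    assume none: "\<not> ?thesis"
    have "?X interior_of (\<Union>(range F)) = {}"
    proof (rule Baire_category_alt)
      show "completely_metrizable_space ?X \<or> locally_compact_space ?X \<and> regular_space ?X"
        using completely_metrizable_space_closedin[OF completely_metrizable_space_euclidean, of "range T"]
          assms(2) by simp
      show "closedin ?X S \<and> ?X interior_of S = {}" if "S \<in> range F" for S
        using that none F_sub by (auto simp: F_def closed_subset)
    qed simp
    moreover have "\<Union>(range F) = range T"
    proof (intro equalityI subsetI)
      fix y assume "y \<in> range T"
      then obtain x where x: "y = T x" by blast
      obtain n where "norm x \<le> real n" using real_arch_simple by blast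
      then have "y \<in> T ` cball 0 (real n)" using x by auto
      then have "y \<in> F n" unfolding F_def by (rule subsetD[OF closure_subset])
      then show "y \<in> \<Union>(range F)" by blast
    qed (use F_sub in blast)
    ultimately show False using interior_of_topspace[of ?X] by simp
  qed
  then obtain n y0 where "y0 \<in> ?X interior_of (F n)" by blast
  then obtain U where U: "openin ?X U" "y0 \<in> U" "U \<subseteq> F n" by (auto simp: interior_of_def)
  then obtain r where r: "r > 0" "ball y0 r \<inter> range T \<subseteq> F n" and y0: "y0 \<in> range T"
    unfolding openin_contains_ball by blast
  \<comment> \<open>\<open>y\<close> is half the difference of the points \<open>y0 + y\<close> and \<open>y0 - y\<close> of the ball around \<open>y0\<close>.\<close>
  have small: "\<exists>x. norm x \<le> real n \<and> norm (y - T x) < \<epsilon>"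
    if y: "y \<in> range T" "norm y < r" and \<epsilon>: "\<epsilon> > 0" for y \<epsilon>
  proof -
    have "y0 + y \<in> range T" "y0 - y \<in> range T"
      using y0 y(1) T.add T.diff by (metis (no_types, lifting) imageE rangeI)+
    moreover have "y0 + y \<in> ball y0 r" "y0 - y \<in> ball y0 r" using y(2) by (simp_all add: dist_norm)
    ultimately have "y0 + y \<in> F n" "y0 - y \<in> F n" using r(2) by blast+
    then obtain x1 x2 where x: "norm x1 \<le> real n" "dist (T x1) (y0 + y) < \<epsilon>"
      "norm x2 \<le> real n" "dist (T x2) (y0 - y) < \<epsilon>"
      using \<epsilon> unfolding F_def closure_approachable by (auto dest!: spec[of _ \<epsilon>])
    let ?x = "(1/2) *\<^sub>R (x1 - x2)"
    have "norm ?x \<le> real n" using x norm_triangle_ineq4[of x1 x2] by simp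
    moreover have "norm (y - T ?x) < \<epsilon>"
    proof -
      have "y - T ?x = (1/2) *\<^sub>R ((y0 + y - T x1) - (y0 - y - T x2))"
        by (simp add: T.scaleR T.diff algebra_simps flip: scaleR_add_left)
      then have "norm (y - T ?x) \<le> (1/2) * (norm (y0 + y - T x1) + norm (y0 - y - T x2))"
        using norm_triangle_ineq4[of "y0 + y - T x1" "y0 - y - T x2"] by simp
      then show ?thesis using x by (simp add: dist_norm norm_minus_commute)
    qed
    ultimately show ?thesis by blast
  qed
  have "\<exists>x. norm x \<le> (2 * real n / r) * norm y \<and> norm (y - T x) < \<epsilon>"
    if y: "y \<in> range T" and \<epsilon>: "\<epsilon> > 0" for y \<epsilon>
  proof (cases "y = 0")
    case False
    \<comment> \<open>Scaling \<open>y\<close> to norm \<open>r / 2\<close> makes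
      \<open>small\<close> applicable; the tolerance \<open>s * \<epsilon>\<close> becomes
      \<open>\<epsilon>\<close> after scaling back.\<close>
    define s where "s = r / (2 * norm y)"
    have s: "s > 0" using False r(1) by (simp add: s_def)
    have "s *\<^sub>R y \<in> range T" using y T.scaleR by (metis (no_types, lifting) imageE rangeI)
    moreover have "norm (s *\<^sub>R y) < r" using False r(1) by (simp add: s_def)
    ultimately obtain x where x: "norm x \<le> real n" "norm (s *\<^sub>R y - T x) < s * \<epsilon>"
      using small[of "s *\<^sub>R y" "s * \<epsilon>"] s \<epsilon> by auto
    have "y - T ((1/s) *\<^sub>R x) = (1/s) *\<^sub>R (s *\<^sub>R y - T x)"
      using s by (simp add: T.scaleR algebra_simps)
    then have "norm (y - T ((1/s) *\<^sub>R x)) = (1/s) * norm (s *\<^sub>R y - T x)"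
      using s by simp
    also have "\<dots> < (1/s) * (s * \<epsilon>)" using x s by (intro mult_strict_left_mono) auto
    finally have "norm (y - T ((1/s) *\<^sub>R x)) < \<epsilon>" using s by simp
    moreover have "norm ((1/s) *\<^sub>R x) \<le> (1/s) * real n"
      using x s by (simp add: divide_right_mono)
    moreover have "(1/s) * real n = (2 * real n / r) * norm y"
      by (simp add: s_def)
    ultimately show ?thesis by metis
  qed (use \<epsilon> in \<open>auto intro: exI[of _ 0] simp: T.zero\<close>)
  then show ?thesis using r(1) by (intro exI[of _ "2 * real n / r"]) auto
qed

text \<open>Successive approximation: each correction by \<open>g\<close> at least halves the
  residual, so the corrections sum to an exact preimage. The geometric series doubles the
  constant.\<close>

lemma closed_range_bounded_preimages:
  fixes T :: "'a :: banach \<Rightarrow> 'b :: banach"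
  assumes "bounded_linear T" "closed (range T)"
  shows "\<exists>C\<ge>0. \<forall>y\<in>range T. \<exists>x. T x = y \<and> norm x \<le> C * norm y"
proof -
  interpret T: bounded_linear T by fact
  obtain C where C: "C \<ge> 0"
    "\<And>y \<epsilon>. y \<in> range T \<Longrightarrow> \<epsilon> > 0 \<Longrightarrow> \<exists>x. norm x \<le> C * norm y \<and> norm (y - T x) < \<epsilon>"
    using closed_range_approximate_preimages[OF assms] by blast
  have "\<exists>x. norm x \<le> C * norm y \<and> norm (y - T x) \<le> norm y / 2" if "y \<in> range T" for y
  proof (cases "y = 0")
    case False
    then show ?thesis using C(2)[OF that, of "norm y / 2"] less_imp_le by auto
  qed (auto intro: exI[of _ 0] simp: T.zero)
  then obtain g where g: "\<And>y. y \<in> range T \<Longrightarrow> norm (g y) \<le> C * norm y"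
    "\<And>y. y \<in> range T \<Longrightarrow> norm (y - T (g y)) \<le> norm y / 2"
    by metis
  have "\<exists>x. T x = y \<and> norm x \<le> (2 * C) * norm y" if y: "y \<in> range T" for y
  proof -
    \<comment> \<open>\<open>s k\<close> is the residual after \<open>k\<close> corrections; the
      series of \<open>T (g (s k))\<close> telescopes to \<open>y\<close>.\<close>
    define s where "s k = ((\<lambda>z. z - T (g z)) ^^ k) y" for k
    have s_Suc: "s (Suc k) = s k - T (g (s k))" for k by (simp add: s_def)
    have s_range: "s k \<in> range T" for k
    proof (induction k)
      case (Suc k)
      then show ?case unfolding s_Suc using T.diff by (metis (no_types, lifting) imageE rangeI)
    qed (simp add: s_def y)
    have s_norm: "norm (s k) \<le> norm y * (1/2) ^ k" for k
    proof (induction k)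
      case (Suc k)
      then show ?case using g(2)[OF s_range[of k]] by (simp add: s_Suc)
    qed (simp add: s_def)
    have gs: "norm (g (s k)) \<le> (C * norm y) * (1/2) ^ k" for k
      using g(1)[OF s_range[of k]] mult_left_mono[OF s_norm[of k] C(1)] by simp
    have geo: "(\<lambda>k. (C * norm y) * (1/2) ^ k) sums ((C * norm y) * 2)"
      using sums_mult[OF geometric_sums[of "1/2 :: real"], of "C * norm y"] by simp
    have summ: "summable (\<lambda>k. norm (g (s k)))"
      by (rule summable_comparison_test'[OF sums_summable[OF geo], of 0]) (simp add: gs)
    define x where "x = (\<Sum>k. g (s k))"
    have "norm x \<le> (\<Sum>k. norm (g (s k)))" unfolding x_def by (rule summable_norm[OF summ])
    also have "\<dots> \<le> (C * norm y) * 2"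
      unfolding sums_unique[OF geo] by (intro suminf_le gs summ sums_summable[OF geo])
    finally have "norm x \<le> (2 * C) * norm y" by (simp add: mult_ac)
    moreover have "T x = y"
    proof (rule sums_unique2)
      show "(\<lambda>k. T (g (s k))) sums T x"
        unfolding x_def by (intro T.sums summable_sums summable_norm_cancel[OF summ])
      have "s \<longlonglongrightarrow> 0"
      proof (rule Lim_null_comparison)
        show "\<forall>\<^sub>F k in sequentially. norm (s k) \<le> norm y * (1/2) ^ k" by (simp add: s_norm)
        show "(\<lambda>k. norm y * (1/2) ^ k) \<longlonglongrightarrow> 0"
          by (intro tendsto_mult_right_zero LIMSEQ_power_zero) simp
      qed
      from telescope_sums'[OF this] show "(\<lambda>k. T (g (s k))) sums y"
        by (simp add: s_Suc) (simp add: s_def)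
    qed
    ultimately show ?thesis by blast
  qed
  then show ?thesis using C(1) by (intro exI[of _ "2 * C"]) auto
qed

text \<open>\<open>Q\<close> projects onto the range of \<open>D\<close>, picks a preimage and
  removes its kernel component. Preimages differ by kernel elements, so the choice does not matter
  and \<open>Q\<close> is linear.\<close>

lemma closed_range_generalized_inverse:
  fixes D :: "'a :: {complex_inner, banach} \<Rightarrow> 'b :: {complex_inner, banach}"
  assumes D: "bounded_clinear D" and "closed (range D)"
  shows "\<exists>Q. bounded_clinear Q \<and> (\<forall>v\<in>orth_complement {x. D x = 0}. Q (D v) = v)"
proof -
  note [simp] = bounded_clinearD(2-5)[OF D]
  define V where "V = orth_complement {x. D x = 0}"
  have V: "closed V" "csubspace V"
    unfolding V_def by (rule closed_orth_complement csubspace_orth_complement)+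
  have R: "closed (range D)" "csubspace (range D)"
  proof -
    show "csubspace (range D)"
      unfolding complex_vector.subspace_def image_iff by (simp; metis bounded_clinearD(2-5)[OF D])
  qed fact
  define P where "P = orth_projection V"
  define P' where "P' = orth_projection (range D)"
  note P = bounded_clinear_orth_projection[OF V, folded P_def]
  note P' = bounded_clinear_orth_projection[OF R, folded P'_def]
  define Q where "Q y = P (SOME x. D x = P' y)" for y
  have P_ker: "P x = 0" if "D x = 0" for x
    unfolding P_def V_def using that by (intro orth_projection_orth_complement_zero) simp
  have Q: "Q y = P x" if "D x = P' y" for x y
  proof -
    have "D (SOME x. D x = P' y) = P' y" by (rule someI) (rule that)
    then have "P ((SOME x. D x = P' y) - x) = 0" by (intro P_ker) (simp add: that)
    then show ?thesis by (simp add: Q_def bounded_clinearD[OF P])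
  qed
  have ex: "\<exists>x. D x = P' y" for y
    using orth_projection_in[OF R, of y] unfolding P'_def by (metis imageE)
  obtain C where C: "C \<ge> 0" "\<And>y. y \<in> range D \<Longrightarrow> \<exists>x. D x = y \<and> norm x \<le> C * norm y"
    using closed_range_bounded_preimages[OF bounded_clinearD(1)[OF D] R(1)] by blast
  obtain K where K: "K \<ge> 0" "\<And>x. norm (P x) \<le> norm x * K"
    using bounded_linear.nonneg_bounded[OF bounded_clinearD(1)[OF P]] by blast
  obtain K' where K': "K' \<ge> 0" "\<And>x. norm (P' x) \<le> norm x * K'"
    using bounded_linear.nonneg_bounded[OF bounded_clinearD(1)[OF P']] by blast
  have "bounded_clinear Q"
  proof (rule bounded_clinearI[of _ "K' * C * K"])
    fix y z c
    obtain x x' where x: "D x = P' y" "D x' = P' z" using ex by metis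
    show "Q (y + z) = Q y + Q z"
      using Q[of "x + x'" "y + z"] x Q by (simp add: bounded_clinearD[OF P] bounded_clinearD[OF P'])
    show "Q (c *\<^sub>C y) = c *\<^sub>C Q y"
      using Q[of "c *\<^sub>C x" "c *\<^sub>C y"] x Q by (simp add: bounded_clinearD[OF P] bounded_clinearD[OF P'])
    \<comment> \<open>As the choice of preimage does not matter, the bound is read off from one of
      controlled norm.\<close>
    obtain u where u: "D u = P' y" "norm u \<le> C * norm (P' y)"
      using C(2)[of "P' y"] ex by (metis rangeI)
    have "norm (Q y) \<le> norm u * K" using Q[OF u(1)] K by simp
    also have "\<dots> \<le> (C * (norm y * K')) * K"
      using u(2) mult_left_mono[OF K'(2)[of y] C(1)] K(1) by (intro mult_right_mono) auto
    finally show "norm (Q y) \<le> norm y * (K' * C * K)" by (simp add: mult_ac)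
  qed
  moreover have "Q (D v) = v" if "v \<in> V" for v
  proof -
    have "P' (D v) = D v" unfolding P'_def by (intro orth_projection_ident R) blast
    then have "Q (D v) = P v" using Q by simp
    also have "\<dots> = v" unfolding P_def by (intro orth_projection_ident V that)
    finally show ?thesis .
  qed
  ultimately show ?thesis unfolding V_def by blast
qed

section \<open>Holomorphy of symbols\<close>

lemma bounded_clinear_shift: "bounded_clinear T \<Longrightarrow> bounded_clinear (\<lambda>x. T x - c *\<^sub>C x)"
  by (intro bounded_clinear_diff bounded_clinear_scaleC)

lemma cinner_shift_adjoint:
  fixes M :: "'n::finite \<Rightarrow> 'h :: {complex_inner, banach} \<Rightarrow> 'h"
  assumes "bounded_clinear (M i)"
  shows "cinner x (shift_adjoint M w i h) = cinner (M i x) h - w $ i * cinner x h"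
  unfolding shift_adjoint_def
  by (subst cinner_cadjoint[OF bounded_clinear_shift[OF assms]])
    (simp add: cinner_diff_left cinner_scaleC_left)

text \<open>Testing the eigenvalue equations for the adjoints of the \<open>M i\<close>, with
  eigenvalues \<open>cnj (w $ i)\<close>, against all \<open>x\<close> removes the adjoints from
  them.\<close>

lemma joint_eigenspace_iff:
  fixes M :: "'n::finite \<Rightarrow> 'h :: {complex_inner, banach} \<Rightarrow> 'h"
  assumes "\<And>i. bounded_clinear (M i)"
  shows "k \<in> joint_eigenspace M w \<longleftrightarrow> (\<forall>i x. cinner (M i x) k = w $ i * cinner x k)"
proof -
  have "shift_adjoint M w i k = 0 \<longleftrightarrow> (\<forall>x. cinner (M i x) k = w $ i * cinner x k)" for i
  proof
    assume "shift_adjoint M w i k = 0"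
    then show "\<forall>x. cinner (M i x) k = w $ i * cinner x k"
      using cinner_shift_adjoint[of M i _ w k, OF assms] by simp
  next
    assume "\<forall>x. cinner (M i x) k = w $ i * cinner x k"
    then show "shift_adjoint M w i k = 0"
      using cinner_shift_adjoint[of M i "shift_adjoint M w i k" w k, OF assms]
      by (metis cinner_self_eq_zero diff_self)
  qed
  then show ?thesis by (simp add: joint_eigenspace_def)
qed

lemma norm_tensor_cnj: "norm (\<chi> i. cnj (a $ i) *\<^sub>C x) = norm a * norm x"
  by (simp add: norm_vec_def L2_set_left_distrib)

lemma cdim_1_obtain:
  assumes "cdim E = 1"
  obtains b where "b \<in> E" "b \<noteq> 0" "\<And>x. x \<in> E \<Longrightarrow> \<exists>c. x = c *\<^sub>C b"
proof -
  obtain B where B: "B \<subseteq> E" "\<not> complex_vector.dependent B" "E \<subseteq> cspan B" "card B = 1"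
    using complex_vector.basis_exists[of E] assms by metis
  then obtain b where b: "B = {b}" by (auto simp: card_1_singleton_iff)
  then have "\<exists>c. x = c *\<^sub>C b" if "x \<in> E" for x
    using B(3) that by (auto simp: complex_vector.span_singleton)
  moreover have "b \<noteq> 0" using B(2) b complex_vector.dependent_zero by blast
  ultimately show ?thesis using that B(1) b by blast
qed

context
  fixes \<Omega> :: "(complex ^ 'n :: finite) set"
    and M :: "'n \<Rightarrow> 'h :: separable_chilbert_space \<Rightarrow> 'h"
  assumes B1: "B1_star \<Omega> M"
begin

lemma B1_star_bounded_clinear: "bounded_clinear (M i)"
  using B1 by (simp add: B1_star_def hilbert_module_def)

lemmas B1_star_eigen_iff = joint_eigenspace_iff[of M, OF B1_star_bounded_clinear]

lemma B1_star_eigenvector: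
  assumes "w \<in> \<Omega>"
  obtains k where "k \<in> joint_eigenspace M w" "k \<noteq> 0"
    "\<And>x. x \<in> joint_eigenspace M w \<Longrightarrow> \<exists>c. x = c *\<^sub>C k"
proof -
  have "cdim (joint_eigenspace M w) = 1" using assms B1 by (simp add: B1_star_def)
  then show ?thesis by (rule cdim_1_obtain) (use that in blast)
qed

text \<open>The orthogonal complement of \<open>x\<close> is a closed subspace; containing all joint
  eigenvectors, it is the whole space and contains \<open>x\<close> itself.\<close>

lemma B1_star_separating:
  assumes "\<And>w k. w \<in> \<Omega> \<Longrightarrow> k \<in> joint_eigenspace M w \<Longrightarrow> cinner x k = 0"
  shows "x = 0"
proof -
  have "(\<Union>w\<in>\<Omega>. joint_eigenspace M w) \<subseteq> orth_complement {x}"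
    using assms cinner_commute[of _ x] by (auto simp: orth_complement_def)
  then have "closure (cspan (\<Union>w\<in>\<Omega>. joint_eigenspace M w)) \<subseteq> orth_complement {x}"
    by (intro closure_minimal complex_vector.span_minimal csubspace_orth_complement
        closed_orth_complement)
  then have "x \<in> orth_complement {x}" using B1 by (auto simp: B1_star_def)
  then show ?thesis by (simp add: orth_complement_def)
qed

lemma joint_eigenspace_scaleC:
  "k \<in> joint_eigenspace M w \<Longrightarrow> c *\<^sub>C k \<in> joint_eigenspace M w"
  by (simp add: B1_star_eigen_iff cinner_scaleC_right)

section \<open>Dependence of eigenvectors and symbols on the point\<close>

text \<open>The component of \<open>k\<close> orthogonal to \<open>k0\<close> is orthogonal to the
  kernel of the column operator \<open>D\<close> at \<open>w0\<close>, so \<open>Q\<close> undoes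
  \<open>D\<close> on it. Its image under \<open>D\<close> is that of \<open>k\<close>, because
  \<open>D k0 = 0\<close>.\<close>

lemma eigenvector_perturbation:
  assumes w0: "w0 \<in> \<Omega>"
  obtains k0 and Q :: "'h ^ 'n \<Rightarrow> 'h" where "k0 \<in> joint_eigenspace M w0" "norm k0 = 1" "bounded_clinear Q"
    "\<And>w k. k \<in> joint_eigenspace M w \<Longrightarrow>
      k - cinner k k0 *\<^sub>C k0 = Q (\<chi> i. cnj ((w - w0) $ i) *\<^sub>C k)"
proof -
  obtain u where u: "u \<in> joint_eigenspace M w0" "u \<noteq> 0"
    "\<And>x. x \<in> joint_eigenspace M w0 \<Longrightarrow> \<exists>c. x = c *\<^sub>C u"
    using B1_star_eigenvector[OF w0] by blast
  define k0 where "k0 = complex_of_real (1 / norm u) *\<^sub>C u"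
  have k0: "k0 \<in> joint_eigenspace M w0" "norm k0 = 1"
    using u by (auto simp: k0_def joint_eigenspace_scaleC norm_divide)
  have mult: "\<exists>c. x = c *\<^sub>C k0" if x: "x \<in> joint_eigenspace M w0" for x
  proof -
    obtain c where "x = c *\<^sub>C u" using u(3)[OF x] by blast
    then have "x = (c * norm u) *\<^sub>C k0" using u(2) by (simp add: k0_def scaleC_scaleC)
    then show ?thesis by blast
  qed
  define D where "D h = (\<chi> i. shift_adjoint M w0 i h)" for h
  have D: "bounded_clinear D"
    unfolding D_def shift_adjoint_def
    by (intro bounded_clinear_vec_lambda bounded_clinear_cadjoint bounded_clinear_shift
        B1_star_bounded_clinear)
  have ker: "D h = 0 \<longleftrightarrow> h \<in> joint_eigenspace M w0" for h
    by (simp add: D_def joint_eigenspace_def vec_eq_iff)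
  have "closed (range D)" using B1 w0 by (simp add: B1_star_def D_def[abs_def])
  from closed_range_generalized_inverse[OF D this] obtain Q where Q: "bounded_clinear Q"
    "\<And>v. v \<in> orth_complement {x. D x = 0} \<Longrightarrow> Q (D v) = v" by blast
  have "k - cinner k k0 *\<^sub>C k0 = Q (\<chi> i. cnj ((w - w0) $ i) *\<^sub>C k)"
    if k: "k \<in> joint_eigenspace M w" for w k
  proof -
    let ?v = "k - cinner k k0 *\<^sub>C k0"
    have "cinner ?v k0 = 0" using k0(2) by (simp add: cinner_diff_left cinner_scaleC_left cinner_self)
    then have "?v \<in> orth_complement {x. D x = 0}"
      unfolding ker orth_complement_def using mult by (force simp: cinner_scaleC_right)
    then have "?v = Q (D ?v)" by (simp add: Q)
    also have "D ?v = D k"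
      using k0(1) by (simp add: bounded_clinearD[OF D] flip: ker)
    also have "D k = (\<chi> i. cnj ((w - w0) $ i) *\<^sub>C k)"
    proof -
      have "D k $ i = cnj ((w - w0) $ i) *\<^sub>C k" for i
        using k by (intro cinner_eqI[of "D k $ i"])
          (simp add: D_def cinner_shift_adjoint B1_star_bounded_clinear cinner_scaleC_right
            B1_star_eigen_iff cinner_diff_right complex_vector.scale_left_diff_distrib algebra_simps)
      then show ?thesis by (simp add: vec_eq_iff)
    qed
    finally show ?thesis .
  qed
  with that[OF k0 Q(1)] show ?thesis by blast
qed

lemma holomorphic_symbol:
  assumes X: "bounded_clinear X"
    and sym: "\<And>w k x. w \<in> \<Omega> \<Longrightarrow> k \<in> joint_eigenspace M w \<Longrightarrow> cinner (X x) k = \<phi> w * cinner x k"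
  shows "holomorphic_map_on \<phi> \<Omega>"
  unfolding holomorphic_map_on_def
proof
  fix w0 assume w0: "w0 \<in> \<Omega>"
  obtain k0 and Q :: "'h ^ 'n \<Rightarrow> 'h" where k0: "k0 \<in> joint_eigenspace M w0" "norm k0 = 1" and Q: "bounded_clinear Q"
    and pert: "\<And>w k. k \<in> joint_eigenspace M w \<Longrightarrow>
      k - cinner k k0 *\<^sub>C k0 = Q (\<chi> i. cnj ((w - w0) $ i) *\<^sub>C k)"
    by (rule eigenvector_perturbation[OF w0]) blast
  obtain K where K: "0 \<le> K" "\<And>z. norm (Q z) \<le> norm z * K"
    using bounded_linear.nonneg_bounded[OF bounded_clinearD(1)[OF Q]] by blast
  have QK: "norm (Q (\<chi> i. cnj (a $ i) *\<^sub>C x)) \<le> norm a * norm x * K" for a x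
    using K(2)[of "\<chi> i. cnj (a $ i) *\<^sub>C x"] by (simp add: norm_tensor_cnj)
  \<comment> \<open>The first-order part of \<open>cinner (X k0) (k - k0)\<close>. Conjugating
    \<open>d\<close> offsets the conjugate linearity of \<open>cinner\<close> in its second
    argument, so \<open>L\<close> is complex linear.\<close>
  define L where "L d = cinner (X k0) (Q (\<chi> i. cnj (d $ i) *\<^sub>C k0))" for d :: "complex ^ 'n"
  \<comment> \<open>Two applications of the bound for \<open>Q\<close> give
    \<open>K\<^sup>2\<close>; the 2 bounds \<open>norm k\<close> for \<open>w\<close> near
    \<open>w0\<close>.\<close>
  define B where "B = norm (X k0) * (2 * K\<^sup>2)"
  have B: "B \<ge> 0" by (simp add: B_def)
  have "bounded_clinear L"
  proof (rule bounded_clinearI[of _ "norm (X k0) * K"])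
    fix c and d e :: "complex ^ 'n"
    have "(\<chi> i. cnj ((d + e) $ i) *\<^sub>C k0) = (\<chi> i. cnj (d $ i) *\<^sub>C k0) + (\<chi> i. cnj (e $ i) *\<^sub>C k0)"
      by (simp add: vec_eq_iff scaleC_add_left)
    then show "L (d + e) = L d + L e"
      by (simp add: L_def bounded_clinearD[OF Q] cinner_add_right)
    have "(\<chi> i. cnj ((c *\<^sub>C d) $ i) *\<^sub>C k0) = cnj c *\<^sub>C (\<chi> i. cnj (d $ i) *\<^sub>C k0)"
      by (simp add: vec_eq_iff scaleC_scaleC) (simp add: scaleC_complex_def)
    then show "L (c *\<^sub>C d) = c *\<^sub>C L d"
      by (simp add: L_def bounded_clinearD[OF Q] cinner_scaleC_right scaleC_complex_def)
    have "norm (L d) \<le> norm (X k0) * norm (Q (\<chi> i. cnj (d $ i) *\<^sub>C k0))"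
      unfolding L_def by (rule norm_cinner_le)
    also have "\<dots> \<le> norm (X k0) * (norm d * K)"
      using QK[of d k0] k0(2) by (intro mult_left_mono) auto
    finally show "norm (L d) \<le> norm d * (norm (X k0) * K)" by (simp add: mult_ac)
  qed
  moreover have est: "norm (\<phi> w - \<phi> w0 - L (w - w0)) \<le> B * (norm (w - w0))\<^sup>2"
    if w: "w \<in> \<Omega>" and small: "norm (w - w0) * K \<le> 1 / 2" for w
  proof -
    let ?d = "w - w0"
    have Qk: "norm (Q (\<chi> i. cnj (?d $ i) *\<^sub>C x)) \<le> norm x / 2" for x
      using QK[of ?d x] mult_right_mono[OF small, of "norm x"] by (simp add: mult_ac)
    obtain u where u: "u \<in> joint_eigenspace M w" "u \<noteq> 0"
      by (rule B1_star_eigenvector[OF w]) blast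
    \<comment> \<open>Otherwise \<open>u\<close> would be a nonzero fixed point of a map that at
      least halves norms.\<close>
    have "cinner u k0 \<noteq> 0"
    proof
      assume "cinner u k0 = 0"
      then have "u = Q (\<chi> i. cnj (?d $ i) *\<^sub>C u)" 
        by (metis pert[OF u(1)] complex_vector.scale_zero_left diff_zero)
      then have "norm u \<le> norm u / 2" using Qk[of u] by metis
      then show False using u(2) by simp
    qed
    \<comment> \<open>This normalisation makes \<open>k - k0\<close> orthogonal to \<open>k0\<close>
      and gives \<open>\<phi> w = cinner (X k0) k\<close>.\<close>
    define k where "k = (1 / cinner u k0) *\<^sub>C u"
    have k: "k \<in> joint_eigenspace M w" "cinner k k0 = 1"
      using u \<open>cinner u k0 \<noteq> 0\<close> by (auto simp: k_def joint_eigenspace_scaleC cinner_scaleC_left)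
    define v where "v = k - k0"
    have v: "v = Q (\<chi> i. cnj (?d $ i) *\<^sub>C k)" using pert[OF k(1)] k(2) by (simp add: v_def scaleC_one)
    have "norm k \<le> 1 + norm v" using norm_triangle_ineq[of k0 v] k0 by (simp add: v_def)
    then have "norm k \<le> 2" using Qk[of k] by (simp add: v)
    then have "norm v \<le> norm ?d * 2 * K"
      using QK[of ?d k] v mult_left_mono[of "norm k" 2 "norm ?d * K"] K(1) by (simp add: mult_ac)
    \<comment> \<open>Inserting \<open>k = k0 + v\<close> into the equation for \<open>v\<close>
      splits off the first-order term; the rest is of second order.\<close>
    have "v = Q (\<chi> i. cnj (?d $ i) *\<^sub>C k0) + Q (\<chi> i. cnj (?d $ i) *\<^sub>C v)"
    proof -
      have "(\<chi> i. cnj (?d $ i) *\<^sub>C k) = (\<chi> i. cnj (?d $ i) *\<^sub>C k0) + (\<chi> i. cnj (?d $ i) *\<^sub>C v)"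
        by (simp add: vec_eq_iff v_def flip: scaleC_add_right)
      from arg_cong[of _ _ Q, OF this] show ?thesis
        unfolding v[symmetric] bounded_clinearD(2)[OF Q] .
    qed
    from arg_cong[of _ _ "cinner (X k0)", OF this]
    have "cinner (X k0) v = L ?d + cinner (X k0) (Q (\<chi> i. cnj (?d $ i) *\<^sub>C v))"
      unfolding L_def cinner_add_right .
    moreover have "\<phi> w = cinner (X k0) k"
      using sym[OF w k(1), of k0] k(2) cinner_commute[of k0 k] by simp
    moreover have "\<phi> w0 = cinner (X k0) k0"
      using sym[OF w0 k0(1), of k0] k0(2) by (simp add: cinner_self)
    ultimately have "\<phi> w - \<phi> w0 - L ?d = cinner (X k0) (Q (\<chi> i. cnj (?d $ i) *\<^sub>C v))"
      by (simp add: v_def cinner_diff_right)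
    also have "norm \<dots> \<le> norm (X k0) * norm (Q (\<chi> i. cnj (?d $ i) *\<^sub>C v))" by (rule norm_cinner_le)
    also have "\<dots> \<le> norm (X k0) * (norm ?d * (norm ?d * 2 * K) * K)"
      using QK[of ?d v] mult_left_mono[OF \<open>norm v \<le> _\<close>, of "norm ?d * K"] K(1)
      by (intro mult_left_mono) (auto simp: mult_ac)
    also have "\<dots> = B * (norm ?d)\<^sup>2" by (simp add: B_def power2_eq_square)
    finally show ?thesis .
  qed
  have "(\<phi> has_derivative L) (at w0 within \<Omega>)"
    unfolding has_derivative_within_alt
  proof (intro conjI allI impI)
    show "bounded_linear L" using \<open>bounded_clinear L\<close> by (rule bounded_clinearD)
    fix e :: real assume e: "e > 0"
    \<comment> \<open>The first bound secures the smallness assumption of \<open>est\<close>; the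
      second absorbs one factor \<open>norm (w - w0)\<close> of the quadratic error.\<close>
    define \<delta> where "\<delta> = min (1 / (2 * K + 1)) (e / (B + 1))"
    have "norm (\<phi> w - \<phi> w0 - L (w - w0)) \<le> e * norm (w - w0)"
      if w: "w \<in> \<Omega>" "norm (w - w0) < \<delta>" for w
    proof -
      have "norm (w - w0) * (2 * K + 1) \<le> 1" "norm (w - w0) * (B + 1) \<le> e"
        using w(2) K(1) B by (auto simp: \<delta>_def field_simps)
      then have "norm (w - w0) * K \<le> 1 / 2" "B * norm (w - w0) \<le> e"
        unfolding distrib_left using norm_ge_zero[of "w - w0"] by (simp_all only: mult.commute mult.left_commute mult_1_left)
      then show ?thesis
        using est[OF w(1)] mult_right_mono[of "B * norm (w - w0)" e "norm (w - w0)"]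
        by (simp add: power2_eq_square mult_ac)
    qed
    moreover have "\<delta> > 0" using e K(1) B by (simp add: \<delta>_def)
    ultimately show "\<exists>d>0. \<forall>y\<in>\<Omega>. norm (y - w0) < d \<longrightarrow> norm (\<phi> y - \<phi> w0 - L (y - w0)) \<le> e * norm (y - w0)"
      by blast
  qed
  with \<open>bounded_clinear L\<close> show "\<exists>D. bounded_clinear D \<and> (\<phi> has_derivative D) (at w0 within \<Omega>)" by blast
qed

text \<open>The adjoint of \<open>X\<close> commutes with the adjoints of the \<open>M i\<close>, so
  it preserves the one-dimensional joint eigenspace at \<open>w\<close> and acts there as a scalar,
  the conjugate of \<open>\<phi> w\<close>.\<close>

lemma commuting_operator_symbol:
  assumes X: "bounded_clinear X" and comm: "\<And>i x. X (M i x) = M i (X x)"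
  obtains \<phi> where "holomorphic_map_on \<phi> \<Omega>"
    "\<And>w k x. w \<in> \<Omega> \<Longrightarrow> k \<in> joint_eigenspace M w \<Longrightarrow> cinner (X x) k = \<phi> w * cinner x k"
proof -
  have "\<exists>c. \<forall>k\<in>joint_eigenspace M w. \<forall>x. cinner (X x) k = c * cinner x k" if w: "w \<in> \<Omega>" for w
  proof -
    obtain u where u: "u \<in> joint_eigenspace M w" "\<And>x. x \<in> joint_eigenspace M w \<Longrightarrow> \<exists>c. x = c *\<^sub>C u"
      by (rule B1_star_eigenvector[OF w]) blast
    have "cadjoint X u \<in> joint_eigenspace M w"
      using u(1) by (simp add: B1_star_eigen_iff cinner_cadjoint[OF X] comm)
    then obtain c where "cadjoint X u = c *\<^sub>C u" using u(2) by blast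
    then have "cinner (X x) u = cnj c * cinner x u" for x
      using cinner_cadjoint[OF X, of x u] by (simp add: cinner_scaleC_right)
    then have "cinner (X x) k = cnj c * cinner x k" if "k \<in> joint_eigenspace M w" for k x
      using u(2)[OF that] by (auto simp: cinner_scaleC_right)
    then show ?thesis by blast
  qed
  then obtain \<phi> where "\<And>w k x. w \<in> \<Omega> \<Longrightarrow> k \<in> joint_eigenspace M w \<Longrightarrow> cinner (X x) k = \<phi> w * cinner x k"
    by metis
  with that holomorphic_symbol[OF X] show ?thesis by blast
qed

end

section \<open>Multiplication operators\<close>

text \<open>For a reproducing kernel vector \<open>k\<close> at \<open>w\<close> this is the value
  of the function \<open>x\<close> at \<open>w\<close>; in general it is the adjoint of
  \<open>\<eta> \<mapsto> k \<otimes>\<^sub>h \<eta>\<close>.\<close>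

definition evaluation :: "'h :: complex_inner \<Rightarrow> 'h ^ 'm \<Rightarrow> complex ^ 'm"
  where "evaluation k x = (\<chi> j. cinner (x $ j) k)"

lemma cinner_tensor_right: "cinner x (k \<otimes>\<^sub>h \<eta>) = cinner (evaluation k x) \<eta>"
  by (simp add: tensor_def evaluation_def cinner_vec_def cinner_scaleC_right
      cinner_complex_def mult.commute)

lemma evaluation_surj:
  assumes "k \<noteq> 0"
  shows "\<exists>x. evaluation k x = \<eta>"
proof
  show "evaluation k ((1 / cinner k k) *\<^sub>C (k \<otimes>\<^sub>h \<eta>)) = \<eta>"
    using assms by (simp add: evaluation_def tensor_def vec_eq_iff cinner_scaleC_left)
qed

lemma bounded_clinear_matrix_vector_mult:
  fixes A :: "complex ^ 'p ^ 'q"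
  shows "bounded_clinear ((*v) A)"
  unfolding bounded_clinear_def
  by (auto simp: matrix_vector_mult_def vec_eq_iff scaleC_complex_def sum_distrib_left mult_ac)

lemma bounded_clinear_ampliation:
  fixes M :: "'n \<Rightarrow> 'h :: complex_inner \<Rightarrow> 'h"
  assumes "bounded_clinear (M i)"
  shows "bounded_clinear (ampliation M i :: 'h ^ 'm \<Rightarrow> 'h ^ 'm)"
proof -
  have "bounded_clinear (\<lambda>x :: 'h ^ 'm. M i (x $ j))" for j
    by (rule bounded_clinear_compose[OF assms bounded_clinear_vec_nth])
  then show ?thesis unfolding ampliation_def[abs_def] by (rule bounded_clinear_vec_lambda)
qed

text \<open>Moving both adjoints across the inner product yields a pointwise form of the eigenvector
  condition, in which composition of operators visibly becomes the matrix product of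
  symbols.\<close>

lemma is_multiplication_operator_iff:
  fixes M :: "'n::finite \<Rightarrow> 'h :: separable_chilbert_space \<Rightarrow> 'h"
    and T :: "'h ^ 'p \<Rightarrow> 'h ^ 'q"
  shows "is_multiplication_operator \<Omega> M F T \<longleftrightarrow>
    bounded_clinear T \<and> (\<forall>i x. T (ampliation M i x) = ampliation M i (T x)) \<and>
    (\<forall>w\<in>\<Omega>. \<forall>k\<in>joint_eigenspace M w. \<forall>x. evaluation k (T x) = F w *v evaluation k x)"
proof -
  have "(\<forall>\<eta>. cadjoint T (k \<otimes>\<^sub>h \<eta>) = k \<otimes>\<^sub>h cadjoint ((*v) (F w)) \<eta>) \<longleftrightarrow>
    (\<forall>x. evaluation k (T x) = F w *v evaluation k x)" if T: "bounded_clinear T" for k w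
  proof -
    have 1: "cinner x (cadjoint T (k \<otimes>\<^sub>h \<eta>)) = cinner (evaluation k (T x)) \<eta>" for x \<eta>
      by (simp add: cinner_cadjoint[OF T] cinner_tensor_right)
    have 2: "cinner x (k \<otimes>\<^sub>h cadjoint ((*v) (F w)) \<eta>) = cinner (F w *v evaluation k x) \<eta>" for x \<eta>
      by (simp add: cinner_cadjoint[OF bounded_clinear_matrix_vector_mult] cinner_tensor_right)
    show ?thesis
    proof
      assume "\<forall>\<eta>. cadjoint T (k \<otimes>\<^sub>h \<eta>) = k \<otimes>\<^sub>h cadjoint ((*v) (F w)) \<eta>"
      then have "cinner (evaluation k (T x)) \<eta> = cinner (F w *v evaluation k x) \<eta>" for x \<eta>
        using 1 2 by metis
      then have "cinner \<eta> (evaluation k (T x)) = cinner \<eta> (F w *v evaluation k x)" for x \<eta>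
        by (metis cinner_commute)
      then show "\<forall>x. evaluation k (T x) = F w *v evaluation k x"
        by (intro allI) (rule cinner_eqI)
    next
      assume "\<forall>x. evaluation k (T x) = F w *v evaluation k x"
      then have "cinner x (cadjoint T (k \<otimes>\<^sub>h \<eta>)) = cinner x (k \<otimes>\<^sub>h cadjoint ((*v) (F w)) \<eta>)" for x \<eta>
        by (simp only: 1 2)
      then show "\<forall>\<eta>. cadjoint T (k \<otimes>\<^sub>h \<eta>) = k \<otimes>\<^sub>h cadjoint ((*v) (F w)) \<eta>"
        by (intro allI) (rule cinner_eqI)
    qed
  qed
  then show ?thesis unfolding is_multiplication_operator_def by blast
qed

lemma is_multiplication_operatorD:
  fixes M :: "'n::finite \<Rightarrow> 'h :: separable_chilbert_space \<Rightarrow> 'h"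
  assumes "is_multiplication_operator \<Omega> M F T"
  shows "bounded_clinear T" "T (ampliation M i x) = ampliation M i (T x)"
    "w \<in> \<Omega> \<Longrightarrow> k \<in> joint_eigenspace M w \<Longrightarrow> evaluation k (T x) = F w *v evaluation k x"
  using assms by (auto simp: is_multiplication_operator_iff)

lemma scalar_multiplierI:
  fixes M :: "'n::finite \<Rightarrow> 'h :: separable_chilbert_space \<Rightarrow> 'h"
  assumes X: "bounded_clinear X" "\<And>i x. X (M i x) = M i (X x)" and \<phi>: "holomorphic_map_on \<phi> \<Omega>"
    and sym: "\<And>w k x. w \<in> \<Omega> \<Longrightarrow> k \<in> joint_eigenspace M w \<Longrightarrow> cinner (X x) k = \<phi> w * cinner x k"
  shows "\<phi> \<in> scalar_multipliers \<Omega> M"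
proof -
  define T :: "'h ^ 1 \<Rightarrow> 'h ^ 1" where "T x = (\<chi> i. X (x $ i))" for x
  have "is_multiplication_operator \<Omega> M (\<lambda>w. mat (\<phi> w)) T"
    unfolding is_multiplication_operator_iff
  proof (intro conjI allI ballI)
    show "bounded_clinear T"
      unfolding T_def
      by (intro bounded_clinear_vec_lambda bounded_clinear_compose[OF X(1)] bounded_clinear_vec_nth)
    show "T (ampliation M i x) = ampliation M i (T x)" for i x
      by (simp add: T_def ampliation_def X(2))
    show "evaluation k (T x) = mat (\<phi> w) *v evaluation k x"
      if "w \<in> \<Omega>" "k \<in> joint_eigenspace M w" for w k x
      using sym[OF that]
      by (simp add: T_def evaluation_def matrix_vector_mult_def mat_def vec_eq_iff sum_1)
  qed
  moreover have "holomorphic_map_on (\<lambda>w. mat (\<phi> w) :: complex ^ 1 ^ 1) \<Omega>"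
    unfolding holomorphic_map_on_def
  proof
    fix w assume "w \<in> \<Omega>"
    then obtain D where D: "bounded_clinear D" "(\<phi> has_derivative D) (at w within \<Omega>)"
      using \<phi> by (auto simp: holomorphic_map_on_def)
    \<comment> \<open>A 1 x 1 matrix has no off-diagonal entries, so \<open>mat c\<close> is the
      constant matrix and linear in \<open>c\<close>.\<close>
    have mat: "bounded_clinear (mat :: complex \<Rightarrow> complex ^ 1 ^ 1)"
    proof -
      have "(mat :: complex \<Rightarrow> complex ^ 1 ^ 1) = (\<lambda>c. \<chi> i j. c)" by (simp add: mat_def fun_eq_iff vec_eq_iff)
      then show ?thesis by (rule ssubst) (intro bounded_clinear_vec_lambda bounded_clinear_id)
    qed
    show "\<exists>D. bounded_clinear D \<and> ((\<lambda>w. mat (\<phi> w) :: complex ^ 1 ^ 1) has_derivative D) (at w within \<Omega>)"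
      using bounded_clinear_compose[OF mat D(1)]
        bounded_linear.has_derivative[OF bounded_clinearD(1)[OF mat] D(2)] by blast
  qed
  ultimately show ?thesis by (auto simp: scalar_multipliers_def multipliers_def)
qed

section \<open>Correspondence of module maps and matrix symbols\<close>

context
  fixes \<Omega> :: "(complex ^ 'n :: finite) set"
    and M :: "'n \<Rightarrow> 'h :: separable_chilbert_space \<Rightarrow> 'h"
  assumes B1: "B1_star \<Omega> M"
begin

lemma ampliation_axis: "ampliation M i (axis j x) = axis j (M i x)"
  using bounded_clinearD(5)[OF B1_star_bounded_clinear[OF B1]]
  by (simp add: ampliation_def axis_def vec_eq_iff)

lemma scalar_multiplierE:
  assumes "\<phi> \<in> scalar_multipliers \<Omega> M"
  obtains X where "bounded_clinear X" "\<And>i x. X (M i x) = M i (X x)"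
    "\<And>w k x. w \<in> \<Omega> \<Longrightarrow> k \<in> joint_eigenspace M w \<Longrightarrow> cinner (X x) k = \<phi> w * cinner x k"
proof -
  obtain T where T: "is_multiplication_operator \<Omega> M (\<lambda>w. mat (\<phi> w) :: complex ^ 1 ^ 1) T"
    using assms by (auto simp: scalar_multipliers_def multipliers_def)
  show ?thesis
  proof (rule that[of "\<lambda>x. T (axis 1 x) $ 1"])
    show "bounded_clinear (\<lambda>x. T (axis 1 x) $ 1)"
      using bounded_clinear_axis_nth[OF is_multiplication_operatorD(1)[OF T]] .
    show "T (axis 1 (M i x)) $ 1 = M i (T (axis 1 x) $ 1)" for i x
      using is_multiplication_operatorD(2)[OF T, of i "axis 1 x"]
      by (simp add: ampliation_axis) (simp add: ampliation_def)
    show "cinner (T (axis 1 x) $ 1) k = \<phi> w * cinner x k"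
      if "w \<in> \<Omega>" "k \<in> joint_eigenspace M w" for w k x
      using is_multiplication_operatorD(3)[OF T that, of "axis 1 x"]
      by (simp add: evaluation_def matrix_vector_mult_def mat_def vec_eq_iff sum_1 axis_def)
  qed
qed

text \<open>Density of the span of the joint eigenvectors, applied in each coordinate. Pointwise
  identities of symbols become operator identities this way.\<close>

lemma vec_eq_by_evaluation:
  assumes "\<And>w k. w \<in> \<Omega> \<Longrightarrow> k \<in> joint_eigenspace M w \<Longrightarrow> evaluation k x = evaluation k y"
  shows "x = y"
proof -
  have "x $ j - y $ j = 0" for j
    using assms by (intro B1_star_separating[OF B1])
      (simp add: evaluation_def vec_eq_iff cinner_diff_left)
  then show ?thesis by (simp add: vec_eq_iff)
qed

lemma multiplication_operator_eq:
  assumes "is_multiplication_operator \<Omega> M F T"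
  shows "multiplication_operator \<Omega> M F = T"
  unfolding multiplication_operator_def
proof (rule the_equality, rule assms, rule ext)
  fix S x assume S: "is_multiplication_operator \<Omega> M F S"
  show "S x = T x"
    by (rule vec_eq_by_evaluation)
      (simp add: is_multiplication_operatorD(3)[OF S] is_multiplication_operatorD(3)[OF assms])
qed

text \<open>The passage from operator identities back to symbols: at a nonzero joint eigenvector the
  vectors \<open>evaluation k x\<close> exhaust the coefficient space.\<close>

lemma symbol_eqI:
  assumes w: "w \<in> \<Omega>"
    and "\<And>k x. k \<in> joint_eigenspace M w \<Longrightarrow> A *v evaluation k x = B *v evaluation k x"
  shows "A = B"
proof -
  obtain k where "k \<in> joint_eigenspace M w" "k \<noteq> 0" by (rule B1_star_eigenvector[OF B1 w]) blast
  then show ?thesis unfolding matrix_eq using assms(2) evaluation_surj by metis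
qed

text \<open>Each matrix entry \<open>X i j\<close> of \<open>T\<close> is an operator on the scalar
  module that commutes with every \<open>M l\<close>, so it has a holomorphic symbol.\<close>

lemma module_map_symbol:
  fixes T :: "'h ^ 'p \<Rightarrow> 'h ^ 'q"
  assumes T: "bounded_clinear T" "\<And>i x. T (ampliation M i x) = ampliation M i (T x)"
  obtains F where "is_multiplication_operator \<Omega> M F T"
    "\<And>i j. (\<lambda>w. F w $ i $ j) \<in> scalar_multipliers \<Omega> M"
proof -
  define X where "X i j x = T (axis j x) $ i" for i j x
  have X: "bounded_clinear (X i j)" for i j
    unfolding X_def
    by (rule bounded_clinear_axis_nth[OF T(1)])
  have comm: "X i j (M l x) = M l (X i j x)" for i j l x
    using T(2)[of l "axis j x"] by (simp add: X_def ampliation_axis) (simp add: ampliation_def)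
  have "\<exists>\<phi>. holomorphic_map_on \<phi> \<Omega> \<and>
      (\<forall>w\<in>\<Omega>. \<forall>k\<in>joint_eigenspace M w. \<forall>x. cinner (X i j x) k = \<phi> w * cinner x k)" for i j
    by (rule commuting_operator_symbol[OF B1, where X = "X i j", OF X comm]) blast
  then obtain \<phi> where \<phi>: "\<And>i j. holomorphic_map_on (\<phi> i j) \<Omega>"
    "\<And>i j w k x. w \<in> \<Omega> \<Longrightarrow> k \<in> joint_eigenspace M w \<Longrightarrow> cinner (X i j x) k = \<phi> i j w * cinner x k"
    by metis
  show ?thesis
  proof (rule that[of "\<lambda>w. \<chi> i j. \<phi> i j w"])
    show "is_multiplication_operator \<Omega> M (\<lambda>w. \<chi> i j. \<phi> i j w) T"
      unfolding is_multiplication_operator_iff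
    proof (intro conjI allI ballI T)
      fix w k x assume wk: "w \<in> \<Omega>" "k \<in> joint_eigenspace M w"
      have "T x $ i = (\<Sum>j\<in>UNIV. X i j (x $ j))" for i
        by (subst vec_sum_axis) (simp add: bounded_clinear_image_sum[OF T(1)] X_def)
      then show "evaluation k (T x) = (\<chi> i j. \<phi> i j w) *v evaluation k x"
        by (simp add: vec_eq_iff evaluation_def matrix_vector_mult_def cinner_sum_left \<phi>(2)[OF wk])
    qed
    show "(\<lambda>w. (\<chi> i j. \<phi> i j w) $ i $ j) \<in> scalar_multipliers \<Omega> M" for i j
      using scalar_multiplierI[of "X i j" M "\<phi> i j", OF X comm \<phi>] by simp
  qed
qed

lemma multiplication_operator_exists:
  assumes "\<And>i j. (\<lambda>w. F w $ i $ j) \<in> scalar_multipliers \<Omega> M"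
  shows "\<exists>T. is_multiplication_operator \<Omega> M F T"
proof -
  have "\<exists>X. bounded_clinear X \<and> (\<forall>l x. X (M l x) = M l (X x)) \<and>
    (\<forall>w\<in>\<Omega>. \<forall>k\<in>joint_eigenspace M w. \<forall>x. cinner (X x) k = F w $ i $ j * cinner x k)" for i j
    by (rule scalar_multiplierE[OF assms]) blast
  then obtain X where X: "\<And>i j. bounded_clinear (X i j)" "\<And>i j l x. X i j (M l x) = M l (X i j x)"
    "\<And>i j w k x. w \<in> \<Omega> \<Longrightarrow> k \<in> joint_eigenspace M w \<Longrightarrow> cinner (X i j x) k = F w $ i $ j * cinner x k"
    by metis
  have "is_multiplication_operator \<Omega> M F (\<lambda>x. \<chi> i. \<Sum>j\<in>UNIV. X i j (x $ j))"
    unfolding is_multiplication_operator_iff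
  proof (intro conjI allI ballI)
    show "bounded_clinear (\<lambda>x. \<chi> i. \<Sum>j\<in>UNIV. X i j (x $ j))"
      by (intro bounded_clinear_vec_lambda bounded_clinear_sum bounded_clinear_compose[OF X(1)]
          bounded_clinear_vec_nth)
    show "(\<chi> i. \<Sum>j\<in>UNIV. X i j (ampliation M l x $ j)) = ampliation M l (\<chi> i. \<Sum>j\<in>UNIV. X i j (x $ j))" for l x
      by (simp add: vec_eq_iff ampliation_def X(2) bounded_clinear_image_sum[OF B1_star_bounded_clinear[OF B1]])
    show "evaluation k (\<chi> i. \<Sum>j\<in>UNIV. X i j (x $ j)) = F w *v evaluation k x"
      if "w \<in> \<Omega>" "k \<in> joint_eigenspace M w" for w k x
      by (simp add: vec_eq_iff evaluation_def matrix_vector_mult_def cinner_sum_left X(3)[OF that])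
  qed
  then show ?thesis by blast
qed

end

text \<open>The inclusion of multiplier classes concerns scalars, so the argument goes through
  matrix entries. \<open>G\<close>, built from \<open>T\<close>, has multiplier entries and agrees
  with \<open>F\<close> on \<open>\<Omega>\<close>.\<close>

lemma multiplication_operator_transfer:
  fixes M :: "'n::finite \<Rightarrow> 'h :: separable_chilbert_space \<Rightarrow> 'h"
    and M' :: "'n \<Rightarrow> 'k :: separable_chilbert_space \<Rightarrow> 'k"
  assumes B1: "B1_star \<Omega> M" and B1': "B1_star \<Omega> M'"
    and sub: "scalar_multipliers \<Omega> M \<subseteq> scalar_multipliers \<Omega> M'"
    and T: "is_multiplication_operator \<Omega> M F T"
  shows "\<exists>T'. is_multiplication_operator \<Omega> M' F T'"
proof -
  obtain G where G: "is_multiplication_operator \<Omega> M G T"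
    "\<And>i j. (\<lambda>w. G w $ i $ j) \<in> scalar_multipliers \<Omega> M"
    by (rule module_map_symbol[OF B1 is_multiplication_operatorD(1,2)[OF T]]) blast
  have "G w = F w" if "w \<in> \<Omega>" for w
    using is_multiplication_operatorD(3)[OF G(1) that] is_multiplication_operatorD(3)[OF T that]
    by (intro symbol_eqI[OF B1 that]) metis
  moreover obtain T' where "is_multiplication_operator \<Omega> M' G T'"
    using multiplication_operator_exists[OF B1', of G] G(2) sub by blast
  ultimately have "is_multiplication_operator \<Omega> M' F T'"
    unfolding is_multiplication_operator_iff by metis
  then show ?thesis by blast
qed

section \<open>Split quotients and similarity\<close>

lemma bounded_clinear_imp_between:
  assumes "bounded_clinear X" "X ` S \<subseteq> T"
  shows "bounded_clinear_between S T X"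
proof -
  obtain K where "\<And>x. norm (X x) \<le> norm x * K"
    using bounded_linear.bounded[OF bounded_clinearD(1)[OF assms(1)]] by blast
  then have "\<exists>K. \<forall>x\<in>S. norm (X x) \<le> K * norm x" by (metis mult.commute)
  then show ?thesis
    using assms(2) by (simp add: bounded_clinear_between_def bounded_clinearD[OF assms(1)])
qed

lemma bounded_clinear_between_compose:
  assumes X: "bounded_clinear_between S T X" and P: "bounded_clinear P" "range P \<subseteq> S"
  shows "bounded_clinear (\<lambda>x. X (P x))"
proof -
  \<comment> \<open>\<open>K\<close> can be negative when \<open>S\<close> is trivial; hence the
    absolute value below.\<close>
  obtain K where K: "\<And>x. x \<in> S \<Longrightarrow> norm (X x) \<le> K * norm x"
    using X unfolding bounded_clinear_between_def by blast
  obtain K' where K': "\<And>x. norm (P x) \<le> norm x * K'"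
    using bounded_linear.bounded[OF bounded_clinearD(1)[OF P(1)]] by blast
  show ?thesis
  proof (rule bounded_clinearI[of _ "K' * \<bar>K\<bar>"])
    fix x y c
    have S: "P z \<in> S" for z using P(2) by blast
    show "X (P (x + y)) = X (P x) + X (P y)" "X (P (c *\<^sub>C x)) = c *\<^sub>C X (P x)"
      using X S by (simp_all add: bounded_clinear_between_def bounded_clinearD[OF P(1)])
    have "norm (X (P x)) \<le> K * norm (P x)" by (rule K[OF S])
    also have "\<dots> \<le> \<bar>K\<bar> * norm (P x)" by (intro mult_right_mono) auto
    also have "\<dots> \<le> \<bar>K\<bar> * (norm x * K')" by (intro mult_left_mono K') simp
    finally show "norm (X (P x)) \<le> norm x * (K' * \<bar>K\<bar>)" by (simp add: mult_ac)
  qed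
qed

lemma closed_kernel: "bounded_clinear T \<Longrightarrow> closed {x. T x = 0}"
  using continuous_closed_vimage[OF closed_singleton linear_continuous_at[OF bounded_clinearD(1)], of T 0]
  by (simp add: vimage_def)

lemma csubspace_kernel: "bounded_clinear T \<Longrightarrow> csubspace {x. T x = 0}"
  by (simp add: complex_vector.subspace_def bounded_clinearD)

text \<open>The range of \<open>T\<close> is the kernel of \<open>A\<close>, so \<open>A\<close>
  descends to the quotient. Its inverse there is \<open>B\<close> followed by the projection onto
  the complement.\<close>

lemma split_similar_quotient:
  fixes S :: "'n \<Rightarrow> 'a :: {complex_inner, banach} \<Rightarrow> 'a"
    and A :: "'a \<Rightarrow> 'b :: complex_inner" and T :: "'c :: complex_inner \<Rightarrow> 'a"
  assumes A: "bounded_clinear A" "\<And>i x. A (S i x) = N i (A x)"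
    and B: "bounded_clinear B"
    and AB: "\<And>y. A (B y) = y" and BA: "\<And>x. B (A x) = x - T (L x)" and AT: "\<And>z. A (T z) = 0"
  shows "similar_modules (quotient_module S (range T)) (full_module N)"
proof -
  have ker: "range T = {x. A x = 0}"
  proof (intro equalityI subsetI)
    fix x assume "x \<in> {x. A x = 0}"
    then have "x = T (L x)" using BA[of x] bounded_clinearD(5)[OF B] by simp
    then show "x \<in> range T" by blast
  qed (use AT in auto)
  let ?V = "orth_complement (range T)" and ?P = "orth_projection (orth_complement (range T))"
  note V = closed_orth_complement[of "range T"] csubspace_orth_complement[of "range T"]
  have "x - ?P x \<in> {x. A x = 0}" for x
    unfolding ker by (intro diff_orth_projection_orth_complement_in closed_kernel csubspace_kernel A)
  then have AP: "A (?P x) = A x" for x by (simp add: bounded_clinearD[OF A(1)])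
  note P_id = orth_projection_ident[OF V(2)]
  have PT: "?P (T z) = 0" for z by (rule orth_projection_orth_complement_zero) blast
  note P = bounded_clinear_orth_projection[OF V]
  show ?thesis
    unfolding similar_modules_def quotient_module_def full_module_def fst_conv snd_conv
  proof (intro exI conjI ballI allI)
    show "bounded_clinear_between ?V UNIV A"
      by (intro bounded_clinear_imp_between A) simp
    show "bounded_clinear_between UNIV ?V (\<lambda>y. ?P (B y))"
      by (intro bounded_clinear_imp_between bounded_clinear_compose[OF P B])
        (use orth_projection_in[OF V] in blast)
    show "?P (B (A x)) = x" if "x \<in> ?V" for x
      using that by (simp add: BA bounded_clinearD[OF P] PT P_id)
    show "A (?P (B y)) = y" for y by (simp add: AP AB)
    show "A (?P (S i x)) = N i (A x)" for i x by (simp add: AP A(2))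
  qed
qed

text \<open>The idempotent \<open>I - T L\<close> is a module map with kernel
  \<open>range T\<close>. \<open>A\<close> is the similarity after the quotient map. The inverse
  \<open>Y\<close> intertwines \<open>N\<close> only with the compression of \<open>S\<close>;
  composing it with \<open>I - T L\<close> gives a genuine module map \<open>B\<close>.\<close>

lemma similar_quotient_split:
  fixes S :: "'n \<Rightarrow> 'a :: {complex_inner, banach} \<Rightarrow> 'a"
    and T :: "'c :: complex_inner \<Rightarrow> 'a" and N :: "'n \<Rightarrow> 'b :: complex_inner \<Rightarrow> 'b"
  assumes T: "bounded_clinear T" "\<And>i z. T (R i z) = S i (T z)"
    and L: "bounded_clinear L" "\<And>i x. L (S i x) = R i (L x)" and LT: "\<And>z. L (T z) = z"
    and S: "\<And>i. bounded_clinear (S i)"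
    and sim: "similar_modules (quotient_module S (range T)) (full_module N)"
  obtains A B where "bounded_clinear A" "\<And>i x. A (S i x) = N i (A x)"
    "bounded_clinear B" "\<And>i y. B (N i y) = S i (B y)"
    "\<And>y. A (B y) = y" "\<And>x. B (A x) = x - T (L x)" "\<And>z. A (T z) = 0"
proof -
  let ?V = "orth_complement (range T)" and ?P = "orth_projection (orth_complement (range T))"
  note V = closed_orth_complement[of "range T"] csubspace_orth_complement[of "range T"]
  note P = bounded_clinear_orth_projection[OF V]
  have P_in: "?P x \<in> ?V" for x by (rule orth_projection_in[OF V])
  note P_id = orth_projection_ident[OF V(2)]
  have E: "bounded_clinear (\<lambda>x. x - T (L x))"
    by (intro bounded_clinear_diff bounded_clinear_id bounded_clinear_compose[OF T(1) L(1)])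
  \<comment> \<open>As the kernel of a bounded operator, the range of \<open>T\<close> is
    closed.\<close>
  have ker: "range T = {x. x - T (L x) = 0}" using LT by (auto intro: rangeI)
  have range_P: "\<exists>z. x - ?P x = T z" for x
  proof -
    have "x - ?P x \<in> {x. x - T (L x) = 0}"
      unfolding ker by (intro diff_orth_projection_orth_complement_in closed_kernel csubspace_kernel E)
    then show ?thesis by auto
  qed
  have PT: "?P (T z) = 0" for z by (rule orth_projection_orth_complement_zero) blast
  \<comment> \<open>\<open>range T\<close> is invariant under \<open>S i\<close>, so the compression
    sees only the class of \<open>x\<close>.\<close>
  have PSP: "?P (S i (?P x)) = ?P (S i x)" for i x
  proof -
    obtain z where "x - ?P x = T z" using range_P by blast
    then have "?P (S i (x - ?P x)) = 0" by (simp add: T(2)[symmetric] PT)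
    then show ?thesis by (simp add: bounded_clinearD[OF P] bounded_clinearD[OF S])
  qed
  \<comment> \<open>\<open>I - T L\<close> kills \<open>range T\<close>, so it factors through the
    quotient.\<close>
  have EP: "?P x - T (L (?P x)) = x - T (L x)" for x
  proof -
    obtain z where "x - ?P x = T z" using range_P by blast
    then have "L x - L (?P x) = z" using LT[of z] bounded_clinearD(3)[OF L(1), of x "?P x"] by simp
    with \<open>x - ?P x = T z\<close> show ?thesis
      by (metis bounded_clinearD(3)[OF T(1)] diff_add_eq diff_diff_eq2 diff_eq_eq add.commute)
  qed
  obtain X Y where X: "bounded_clinear_between ?V UNIV X" and Y: "bounded_clinear_between UNIV ?V Y"
    and YX: "\<And>x. x \<in> ?V \<Longrightarrow> Y (X x) = x" and XY: "\<And>y. X (Y y) = y"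
    and XS: "\<And>i x. x \<in> ?V \<Longrightarrow> X (?P (S i x)) = N i (X x)"
    using sim unfolding similar_modules_def quotient_module_def full_module_def by auto
  have Y_in: "Y y \<in> ?V" for y using Y by (auto simp: bounded_clinear_between_def)
  have YN: "Y (N i y) = ?P (S i (Y y))" for i y
    using XS[OF Y_in, of i y] XY YX P_in by metis
  \<comment> \<open>\<open>X\<close> is known to be linear on \<open>?V\<close> alone, so
    homogeneity is used there with the scalar 0.\<close>
  have X0: "X 0 = 0" using X YX
    by (metis (mono_tags, lifting) bounded_clinear_between_def complex_vector.scale_zero_left
        complex_vector.subspace_0[OF V(2)])
  have Y_bdd: "bounded_clinear Y"
    using bounded_clinear_between_compose[OF Y bounded_clinear_id] by simp
  show ?thesis
  proof (rule that[of "\<lambda>x. X (?P x)" "\<lambda>y. Y y - T (L (Y y))"])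
    show "bounded_clinear (\<lambda>x. X (?P x))"
      by (rule bounded_clinear_between_compose[OF X P]) (use P_in in blast)
    show "X (?P (S i x)) = N i (X (?P x))" for i x
      using XS[OF P_in, of i x] by (simp add: PSP)
    show "bounded_clinear (\<lambda>y. Y y - T (L (Y y)))" by (rule bounded_clinear_compose[OF E Y_bdd])
    show "Y (N i y) - T (L (Y (N i y))) = S i (Y y - T (L (Y y)))" for i y
      unfolding YN EP by (simp add: bounded_clinearD[OF S] L T)
    show "X (?P (Y y - T (L (Y y)))) = y" for y
      by (simp add: bounded_clinearD[OF P] PT P_id Y_in XY)
    show "Y (X (?P x)) - T (L (Y (X (?P x)))) = x - T (L x)" for x
      by (simp add: YX P_in EP)
    show "X (?P (T z)) = 0" for z by (simp add: PT X0)
  qed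
qed

section \<open>Transfer of the similarity to the second module\<close>

theorem theorem6p3:
  fixes \<Omega> :: "(complex ^ 'n :: finite) set"
    and M :: "'n \<Rightarrow> 'h :: separable_chilbert_space \<Rightarrow> 'h"
    and M' :: "'n \<Rightarrow> 'k :: separable_chilbert_space \<Rightarrow> 'k"
    and \<Theta> :: "complex ^ 'n \<Rightarrow> complex ^ 'p :: finite ^ 'q :: finite"
  assumes "open \<Omega>" and "connected \<Omega>" and "\<Omega> \<noteq> {}" and "bounded \<Omega>"
    and "B1_star \<Omega> M" and "B1_star \<Omega> M'"
    and "scalar_multipliers \<Omega> M \<subseteq> scalar_multipliers \<Omega> M'"
    and "1 \<le> CARD('p)" and "CARD('p) < CARD('q)"
    and "CARD('r :: finite) = CARD('q) - CARD('p)"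
    and "\<Theta> \<in> multipliers \<Omega> M" and "left_invertible_multiplier \<Omega> M \<Theta>"
    and "similar_modules (multiplier_quotient \<Omega> M \<Theta>)
           (full_module (ampliation M :: 'n \<Rightarrow> 'h ^ 'r \<Rightarrow> 'h ^ 'r))"
  shows "similar_modules (multiplier_quotient \<Omega> M' \<Theta>)
           (full_module (ampliation M' :: 'n \<Rightarrow> 'k ^ 'r \<Rightarrow> 'k ^ 'r))"
proof -
  note B1 = \<open>B1_star \<Omega> M\<close> and B1' = \<open>B1_star \<Omega> M'\<close>
  note transfer = multiplication_operator_transfer[OF B1 B1' assms(7)]
  obtain T where T: "is_multiplication_operator \<Omega> M \<Theta> T"
    using assms(11) by (auto simp: multipliers_def)
  obtain \<Psi> L where L: "is_multiplication_operator \<Omega> M \<Psi> L"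
    and \<Psi>: "\<And>w. w \<in> \<Omega> \<Longrightarrow> \<Psi> w ** \<Theta> w = mat 1"
    using assms(12) by (auto simp: left_invertible_multiplier_def multipliers_def)
  note ev = is_multiplication_operatorD(3)
  have LT: "L (T z) = z" for z
    by (rule vec_eq_by_evaluation[OF B1])
      (simp add: ev[OF L] ev[OF T] \<Psi> matrix_vector_mul_assoc)
  have sim: "similar_modules (quotient_module (ampliation M) (range T))
      (full_module (ampliation M :: 'n \<Rightarrow> 'h ^ 'r \<Rightarrow> 'h ^ 'r))"
    using assms(13) by (simp add: multiplier_quotient_def multiplication_operator_eq[OF B1 T])
  obtain A :: "'h ^ 'q \<Rightarrow> 'h ^ 'r" and B
    where A: "bounded_clinear A" "\<And>i x. A (ampliation M i x) = ampliation M i (A x)"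
      and B: "bounded_clinear B" "\<And>i y. B (ampliation M i y) = ampliation M i (B y)"
      and AB: "\<And>y. A (B y) = y" and BA: "\<And>x. B (A x) = x - T (L x)" and AT: "\<And>z. A (T z) = 0"
  proof (rule similar_quotient_split[where T = T and L = L and R = "ampliation M" and S = "ampliation M"
        and N = "ampliation M :: 'n \<Rightarrow> 'h ^ 'r \<Rightarrow> 'h ^ 'r"])
    show "bounded_clinear T" "T (ampliation M i z) = ampliation M i (T z)" for i z
      by (rule is_multiplication_operatorD[OF T])+
    show "bounded_clinear L" "L (ampliation M i x) = ampliation M i (L x)" for i x
      by (rule is_multiplication_operatorD[OF L])+
    show "bounded_clinear (ampliation M i :: 'h ^ 'q \<Rightarrow> 'h ^ 'q)" for i
      by (intro bounded_clinear_ampliation B1_star_bounded_clinear[OF B1])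
  qed (use LT sim in blast)+
  obtain F where F: "is_multiplication_operator \<Omega> M F A" by (rule module_map_symbol[OF B1 A])
  obtain G where G: "is_multiplication_operator \<Omega> M G B" by (rule module_map_symbol[OF B1 B])
  have evaluation_linear: "evaluation k (x - y) = evaluation k x - evaluation k y" "evaluation k 0 = 0"
    for k :: "'c :: complex_inner" and x y :: "'c ^ 'm :: finite"
    by (simp_all add: evaluation_def vec_eq_iff cinner_diff_left)
  \<comment> \<open>The identities for \<open>A\<close> and \<open>B\<close> pass to the symbols on
    \<open>\<Omega>\<close>, in a form that no longer mentions the module.\<close>
  have FG: "F w ** G w = mat 1" if "w \<in> \<Omega>" for w
    by (rule symbol_eqI[OF B1 that])
      (simp add: matrix_vector_mul_assoc[symmetric] ev[OF F that, symmetric] ev[OF G that, symmetric] AB)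
  have GF: "G w ** F w = mat 1 - \<Theta> w ** \<Psi> w" if "w \<in> \<Omega>" for w
    by (rule symbol_eqI[OF B1 that])
      (simp add: matrix_vector_mult_diff_rdistrib matrix_vector_mul_assoc[symmetric]
        ev[OF F that, symmetric] ev[OF G that, symmetric] ev[OF T that, symmetric]
        ev[OF L that, symmetric] BA evaluation_linear)
  have F\<Theta>: "F w ** \<Theta> w = 0" if "w \<in> \<Omega>" for w
    by (rule symbol_eqI[OF B1 that])
      (simp add: matrix_vector_mul_assoc[symmetric] ev[OF F that, symmetric] ev[OF T that, symmetric]
        AT evaluation_linear)
  \<comment> \<open>The same four symbols act on the second module, where the pointwise identities
    are read back as operator identities.\<close>
  obtain T' L' A' B' where T': "is_multiplication_operator \<Omega> M' \<Theta> T'"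
    and L': "is_multiplication_operator \<Omega> M' \<Psi> L'"
    and A': "is_multiplication_operator \<Omega> M' F A'"
    and B': "is_multiplication_operator \<Omega> M' G B'"
    using transfer[OF T] transfer[OF L] transfer[OF F] transfer[OF G] by blast
  have "similar_modules (quotient_module (ampliation M') (range T'))
      (full_module (ampliation M' :: 'n \<Rightarrow> 'k ^ 'r \<Rightarrow> 'k ^ 'r))"
  proof (rule split_similar_quotient[where A = A' and B = B' and L = L'])
    show "bounded_clinear A'" "A' (ampliation M' i x) = ampliation M' i (A' x)" for i x
      by (rule is_multiplication_operatorD[OF A'])+
    show "bounded_clinear B'" by (rule is_multiplication_operatorD[OF B'])
    show "A' (B' y) = y" for y
      by (rule vec_eq_by_evaluation[OF B1'])
        (simp add: ev[OF A'] ev[OF B'] FG matrix_vector_mul_assoc)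
    show "B' (A' x) = x - T' (L' x)" for x
      by (rule vec_eq_by_evaluation[OF B1'])
        (simp add: ev[OF A'] ev[OF B'] ev[OF T'] ev[OF L'] GF matrix_vector_mul_assoc
          matrix_vector_mult_diff_rdistrib evaluation_linear)
    show "A' (T' z) = 0" for z
      by (rule vec_eq_by_evaluation[OF B1'])
        (simp add: ev[OF A'] ev[OF T'] F\<Theta> matrix_vector_mul_assoc evaluation_linear)
  qed
  then show ?thesis by (simp add: multiplier_quotient_def multiplication_operator_eq[OF B1' T'])
qed

end
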